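(* Let $\Gamma$ be any graph with $\nu=\nu(\Gamma)\ge 2$, and let $n$ be an integer satisfying $2\le n\le\nu$, with $\Gamma$ sufficiently subdivided for $n$. Then $\mathrm{TC}(\mathrm{D}^{n}(\Gamma))=2n+1$.
   Context: Graphs are finite connected 1-dimensional CW complexes; the vertices are the 0-cells and an edge means the closure of a 1-cell. A cycle is a sequence of vertices $(v_1,\dots,v_k,v_1)$ with $v_1,\dots,v_k$ distinct, together with edges joining consecutive vertices (cyclically), forming an embedded circle in $\Gamma$. Two cycles are vertex-disjoint if they have no vertices in common; $\nu(\Gamma)$ is the maximum cardinality of a collection of pairwise vertex-disjoint cycles in $\Gamma$. Topological complexity: for a path-connected space $X$, let $P(X)$ be the space of continuous paths $I\to X$ and $p:P(X)\to X\times X$, $p(\sigma)=(\sigma(0),\sigma(1))$. $\mathrm{TC}(X)$ is the smallest integer $k$ such that $X\times X$ is covered by open sets $U_1,\dots,U_k$ each admitting a continuous section $U_i\to P(X)$ of $p$ ($\infty$ if no such $k$ exists). Ordered discrete configuration space: $\mathrm{D}^n(\Gamma)\subset\Gamma^n$ is the subcomplex consisting of all open cells $c_1\times\cdots\times c_n$ (each $c_i$ a vertex or an open edge of $\Gamma$) with $\overline{c_i}\cap\overline{c_j}=\emptyset$ for $i\neq j$. $\Gamma$ is sufficiently subdivided for $n$ if it has at least $n$ vertices, each path between distinct vertices of degree not equal to $2$ contains at least $n-1$ edges, and each loop at a vertex that is not homotopic to a constant map contains at least $n+1$ edges. *)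

theory Defs
  imports "HOL-Analysis.Analysis"
begin

text \<open>A graph is a space with a finite CW structure of dimension at most one: the 0-cells are the
  elements of \<open>verts\<close>, and the 1-cells are indexed by \<open>edges\<close>, with characteristic maps
  \<open>char_map e\<close> defined on the interval \<open>{0..1}\<close>.\<close>

record ('a, 'e) graph =
  carrier_top :: "'a topology"
  verts :: "'a set"
  edges :: "'e set"
  char_map :: "'e \<Rightarrow> real \<Rightarrow> 'a"

definition open_edge :: "('a, 'e) graph \<Rightarrow> 'e \<Rightarrow> 'a set" where
  "open_edge G e = char_map G e ` {0<..<1}"

definition closed_edge :: "('a, 'e) graph \<Rightarrow> 'e \<Rightarrow> 'a set" where
  "closed_edge G e = carrier_top G closure_of open_edge G e"

text \<open>There are finitely many cells and the space is Hausdorff, so the weak topology condition on a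
  CW complex is automatic.\<close>

definition is_graph :: "('a, 'e) graph \<Rightarrow> bool" where
  "is_graph G \<longleftrightarrow>
     Hausdorff_space (carrier_top G) \<and> connected_space (carrier_top G) \<and>
     finite (verts G) \<and> finite (edges G) \<and>
     (\<forall>e\<in>edges G.
        continuous_map (top_of_set {0..1}) (carrier_top G) (char_map G e) \<and>
        embedding_map (top_of_set {0<..<1}) (carrier_top G) (char_map G e) \<and>
        char_map G e 0 \<in> verts G \<and> char_map G e 1 \<in> verts G) \<and>
     disjoint_family_on (open_edge G) (edges G) \<and>
     (\<forall>e\<in>edges G. open_edge G e \<inter> verts G = {}) \<and>
     topspace (carrier_top G) = verts G \<union> (\<Union>e\<in>edges G. open_edge G e)"

definition joins :: "('a, 'e) graph \<Rightarrow> 'e \<Rightarrow> 'a \<Rightarrow> 'a \<Rightarrow> bool" where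
  "joins G e u v \<longleftrightarrow> {char_map G e 0, char_map G e 1} = {u, v}"

text \<open>An edge with both ends at \<open>v\<close> contributes 2 to the degree.\<close>

definition degree :: "('a, 'e) graph \<Rightarrow> 'a \<Rightarrow> nat" where
  "degree G v = card {e \<in> edges G. char_map G e 0 = v} + card {e \<in> edges G. char_map G e 1 = v}"

text \<open>The list \<open>vs\<close> does not repeat the initial vertex at the end. The last conjunct
  excludes traversing one edge back and forth; cycles with one or two vertices are allowed.\<close>

definition is_cycle :: "('a, 'e) graph \<Rightarrow> 'a list \<times> 'e list \<Rightarrow> bool" where
  "is_cycle G = (\<lambda>(vs, es).
     vs \<noteq> [] \<and> distinct vs \<and> set vs \<subseteq> verts G \<and>
     length es = length vs \<and> set es \<subseteq> edges G \<and>
     (\<forall>i<length vs. joins G (es ! i) (vs ! i) (vs ! (Suc i mod length vs))) \<and>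
     subtopology (carrier_top G) (\<Union>e\<in>set es. closed_edge G e)
       homeomorphic_space top_of_set (sphere (0::complex) 1))"

definition nu :: "('a, 'e) graph \<Rightarrow> nat" where
  "nu G = Max {card C | C. (\<forall>c\<in>C. is_cycle G c) \<and>
                 pairwise (\<lambda>c d. set (fst c) \<inter> set (fst d) = {}) C}"

definition edge_count :: "('a, 'e) graph \<Rightarrow> (real \<Rightarrow> 'a) \<Rightarrow> nat" where
  "edge_count G g = card {e \<in> edges G. closed_edge G e \<subseteq> g ` {0..1}}"

text \<open>The homotopy to a constant map runs through loops, i.e. it is a homotopy of maps from the
  circle.\<close>

definition sufficiently_subdivided :: "('a, 'e) graph \<Rightarrow> nat \<Rightarrow> bool" where
  "sufficiently_subdivided G n \<longleftrightarrow>
     n \<le> card (verts G) \<and>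
     (\<forall>g. pathin (carrier_top G) g \<and> g 0 \<in> verts G \<and> g 1 \<in> verts G \<and> g 0 \<noteq> g 1 \<and>
          degree G (g 0) \<noteq> 2 \<and> degree G (g 1) \<noteq> 2 \<longrightarrow> n - 1 \<le> edge_count G g) \<and>
     (\<forall>g. pathin (carrier_top G) g \<and> g 0 \<in> verts G \<and> g 1 = g 0 \<and>
          (\<nexists>a. homotopic_with (\<lambda>h. h 0 = h 1) (top_of_set {0..1}) (carrier_top G) g (\<lambda>_. a))
          \<longrightarrow> n + 1 \<le> edge_count G g)"

definition cells :: "('a, 'e) graph \<Rightarrow> 'a set set" where
  "cells G = (\<lambda>v. {v}) ` verts G \<union> open_edge G ` edges G"

definition disc_conf :: "nat \<Rightarrow> ('a, 'e) graph \<Rightarrow> (nat \<Rightarrow> 'a) topology" where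
  "disc_conf n G =
     subtopology (product_topology (\<lambda>_. carrier_top G) {..<n})
       (\<Union>{PiE {..<n} c | c. (\<forall>i<n. c i \<in> cells G) \<and>
             (\<forall>i<n. \<forall>j<n. i \<noteq> j \<longrightarrow>
                (carrier_top G closure_of c i) \<inter> (carrier_top G closure_of c j) = {})})"

text \<open>Paths are normalised to be \<open>undefined\<close> outside \<open>{0..1}\<close>; the topology is the compact-open
  one.\<close>

definition paths :: "'a topology \<Rightarrow> (real \<Rightarrow> 'a) set" where
  "paths X = {s. pathin X s \<and> s \<in> extensional {0..1}}"

definition path_space :: "'a topology \<Rightarrow> (real \<Rightarrow> 'a) topology" where
  "path_space X =
     topology_generated_by
       {{s \<in> paths X. s ` K \<subseteq> W} | K W. compact K \<and> K \<subseteq> {0..1} \<and> openin X W}"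

lemma topspace_path_space: "topspace (path_space X) = paths X"
proof -
  have "paths X \<in> {{s \<in> paths X. s ` K \<subseteq> W} | K W. compact K \<and> K \<subseteq> {0..1} \<and> openin X W}"
    by (rule CollectI, rule exI[of _ "{}"], rule exI[of _ "{}"]) auto
  then show ?thesis
    unfolding path_space_def topology_generated_by_topspace by blast
qed

definition path_ends :: "(real \<Rightarrow> 'a) \<Rightarrow> 'a \<times> 'a" where
  "path_ends s = (s 0, s 1)"

definition has_section_on :: "'a topology \<Rightarrow> ('a \<times> 'a) set \<Rightarrow> bool" where
  "has_section_on X U \<longleftrightarrow>
     (\<exists>s. continuous_map (subtopology (prod_topology X X) U) (path_space X) s \<and>
          (\<forall>z\<in>U. path_ends (s z) = z))"

text \<open>The infimum of the empty set is \<open>\<infinity>\<close>; this is in particular the value at every space that is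
  not path-connected.\<close>

definition TC :: "'a topology \<Rightarrow> enat" where
  "TC X = Inf {enat k | k. \<exists>U :: nat \<Rightarrow> ('a \<times> 'a) set.
     (\<forall>i<k. openin (prod_topology X X) (U i) \<and> has_section_on X (U i)) \<and>
     (\<Union>i<k. U i) = topspace (prod_topology X X)}"

end

theory Submission
  imports Defs
begin

text \<open>Write \<open>D\<close> for the discrete configuration space. A point of \<open>D\<close> is a tuple of points of the graph
  whose closed cells are pairwise disjoint; equivalently, the sets of vertices of these closed cells,
  called corners below, are pairwise disjoint. Both bounds use this description.

  Upper bound. The two entries of a point of \<open>D \<times> D\<close> consist together of \<open>2 * n\<close> points of the graph.
  Let the height of a point be the distance, in the parameter of its edge, to the nearer end. Among
  \<open>2 * n + 1\<close> different thresholds there is one that is not the height of any of the \<open>2 * n\<close> points, so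
  \<open>2 * n + 1\<close> open sets, each given by the avoidance of one threshold, cover \<open>D \<times> D\<close>. On such a set
  all points can slide continuously, those below the threshold to the nearer vertex and those above it
  to the middle of their edge. Sliding never enlarges the set of corners, hence it stays in \<open>D\<close>, and it
  ends in a finite set of configurations. Chosen paths between these configurations complete
  a section (\<open>has_section_on_deformable\<close>, \<open>TC_disc_conf_le\<close>).

  The chosen paths exist because \<open>D\<close> is path connected, which is a statement about moving labelled
  tokens on the vertices of the graph. Unlabelled tokens can be moved to any set of vertices. Labelled
  tokens can be permuted arbitrarily on a cycle with more than \<open>n\<close> vertices from which an edge leads
  out: they rotate along the cycle, and two neighbours change places where the extra edge is attached
  (\<open>placements_reachable\<close>). The subdivision hypothesis makes every cycle that long, because the loop
  around a cycle is not null-homotopic (\<open>length_cycle_ge\<close>).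

  Lower bound. Collapsing the complement of one edge of a cycle gives a map from the graph to the
  circle that has degree one on this cycle and is constant on every cycle without common vertices. Let token \<open>i\<close>
  run around the \<open>i\<close>-th of \<open>n\<close> disjoint cycles, independently of the other tokens: this is an
  \<open>n\<close>-torus in \<open>D\<close>. Letting token \<open>i\<close> run around the next cycle instead gives a second one. On the
  product of the two tori, which is a \<open>2 * n\<close>-torus in \<open>D \<times> D\<close>, the collapsing maps give \<open>2 * n\<close> maps
  \<open>D \<rightarrow> S\<^sup>1\<close> such that, when the \<open>j\<close>-th coordinate of the \<open>2 * n\<close>-torus makes a full circle, the \<open>j\<close>-th map
  makes a full turn at one entry of the pair and none at the other. A section over an open set therefore yields a
  real-valued lift of a circle-valued coordinate over this set; and \<open>2 * n\<close> sets on which the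
  respective coordinates lift do not cover the \<open>2 * n\<close>-torus (\<open>number_of_sections_gt\<close>).
  In cohomological terms, the zero-divisor cup length is at least \<open>2 * n\<close>; the proof replaces
  cup products by Kuhn's combinatorial lemma, and degrees by turning numbers of paths.\<close>

section \<open>Path spaces and sections\<close>

lemma pathin_iff: "pathin X g \<longleftrightarrow> continuous_map (top_of_set {0..1}) X g"
  by (simp add: pathin_def)

text \<open>One half of the exponential law. Compactness of \<open>K\<close> enters through the tube lemma.\<close>

lemma continuous_map_into_path_space:
  assumes H: "continuous_map (prod_topology Y (top_of_set {0..1})) X (\<lambda>(y, t). H y t)"
  shows "continuous_map Y (path_space X) (\<lambda>y. restrict (H y) {0..1})"
proof -
  have paths: "restrict (H y) {0..1} \<in> paths X" if "y \<in> topspace Y" for y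
  proof -
    have "continuous_map (top_of_set {0..1}) (prod_topology Y (top_of_set {0..1})) (\<lambda>t. (y, t))"
      using that by (intro continuous_map_pairedI) auto
    then have "continuous_map (top_of_set {0..1}) X (H y)"
      using continuous_map_compose[OF _ H] by (force simp: o_def)
    then have "continuous_map (top_of_set {0..1}) X (restrict (H y) {0..1})"
      by (rule continuous_map_eq) auto
    then show ?thesis
      by (simp add: paths_def pathin_iff)
  qed
  have opn: "openin Y ((\<lambda>y. restrict (H y) {0..1}) -` {s \<in> paths X. s ` K \<subseteq> W} \<inter> topspace Y)"
    if K: "compact K" "K \<subseteq> {0..1}" and W: "openin X W" for K W
  proof (subst openin_subopen, intro ballI)
    fix y assume y: "y \<in> (\<lambda>y. restrict (H y) {0..1}) -` {s \<in> paths X. s ` K \<subseteq> W} \<inter> topspace Y"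
    let ?P = "{z \<in> topspace (prod_topology Y (top_of_set {0..1})). (\<lambda>(y, t). H y t) z \<in> W}"
    have "openin (prod_topology Y (top_of_set {0..1})) ?P"
      using H W by (rule openin_continuous_map_preimage)
    moreover have "compactin (top_of_set {0..1}) K"
      using K by (simp add: compactin_subtopology)
    moreover have "{y} \<times> K \<subseteq> ?P"
      using y K by (auto simp: subset_iff image_subset_iff)
    ultimately obtain U V where UV: "openin Y U" "y \<in> U" "K \<subseteq> V" "U \<times> V \<subseteq> ?P"
      using tube_lemma_right[of Y "top_of_set {0..1}" ?P K y] y by auto
    have "U \<subseteq> (\<lambda>y. restrict (H y) {0..1}) -` {s \<in> paths X. s ` K \<subseteq> W} \<inter> topspace Y"
      using UV K paths openin_subset[OF UV(1)] by (auto simp: subset_iff image_subset_iff)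
    then show "\<exists>T. openin Y T \<and> y \<in> T \<and> T \<subseteq> (\<lambda>y. restrict (H y) {0..1}) -` {s \<in> paths X. s ` K \<subseteq> W} \<inter> topspace Y"
      using UV by blast
  qed
  show ?thesis
    unfolding path_space_def continuous_on_generated_topo_iff
  proof (intro conjI allI impI)
    fix U assume "U \<in> {{s \<in> paths X. s ` K \<subseteq> W} | K W. compact K \<and> K \<subseteq> {0..1} \<and> openin X W}"
    then show "openin Y ((\<lambda>y. restrict (H y) {0..1}) -` U \<inter> topspace Y)"
      using opn by auto
  next
    show "(\<lambda>y. restrict (H y) {0..1}) ` topspace Y
        \<subseteq> \<Union> {{s \<in> paths X. s ` K \<subseteq> W} | K W. compact K \<and> K \<subseteq> {0..1} \<and> openin X W}"
      using paths topspace_path_space[of X]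
      unfolding path_space_def topology_generated_by_topspace by auto
  qed
qed

text \<open>The other half of the exponential law. It needs that the unit interval is locally compact: a path
  that is in \<open>W\<close> at time \<open>t\<close> maps a compact neighbourhood of \<open>t\<close> to \<open>W\<close>.\<close>

lemma continuous_map_from_path_space:
  assumes s: "continuous_map Y (path_space X) s"
  shows "continuous_map (prod_topology Y (top_of_set {0..1})) X (\<lambda>(y, t). s y t)"
  unfolding continuous_map_def
proof (intro conjI allI impI)
  have paths: "s y \<in> paths X" if "y \<in> topspace Y" for y
    using s that continuous_map_image_subset_topspace topspace_path_space by fastforce
  then have "s y t \<in> topspace X" if "y \<in> topspace Y" "t \<in> {0..1}" for y t
    using that unfolding paths_def pathin_iff by (fastforce simp: continuous_map_def)
  then show "(\<lambda>(y, t). s y t) \<in> topspace (prod_topology Y (top_of_set {0..1})) \<rightarrow> topspace X"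
    by auto
  fix W assume W: "openin X W"
  show "openin (prod_topology Y (top_of_set {0..1}))
      {z \<in> topspace (prod_topology Y (top_of_set {0..1})). (\<lambda>(y, t). s y t) z \<in> W}" (is "openin _ ?P")
  proof (subst openin_subopen, intro ballI)
    fix z assume z: "z \<in> ?P"
    obtain y t where yt: "z = (y, t)" by force
    have y: "y \<in> topspace Y" and t: "t \<in> {0..1}" and sW: "s y t \<in> W"
      using z yt by auto
    have "continuous_map (top_of_set {0..1}) X (s y)"
      using paths[OF y] by (simp add: paths_def pathin_iff)
    then have "openin (top_of_set {0..1}) {u \<in> {0..1}. s y u \<in> W}"
      using W openin_continuous_map_preimage by fastforce
    then obtain \<epsilon> where e: "\<epsilon> > 0" "\<And>u. u \<in> {0..1} \<Longrightarrow> dist u t < \<epsilon> \<Longrightarrow> s y u \<in> W"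
      using t sW unfolding openin_euclidean_subtopology_iff by blast
    define K where "K = cball t (\<epsilon>/2) \<inter> {0..1}"
    have K: "compact K" "K \<subseteq> {0..1}" by (auto simp: K_def)
    have sK: "s y ` K \<subseteq> W"
      using e by (auto simp: K_def dist_commute)
    let ?N = "{r \<in> paths X. r ` K \<subseteq> W}"
    have "openin (path_space X) ?N"
      unfolding path_space_def using K W by (intro topology_generated_by_Basis) auto
    then have N: "openin Y {y \<in> topspace Y. s y \<in> ?N}"
      using s openin_continuous_map_preimage by fastforce
    have B: "openin (top_of_set {0..1}) (ball t (\<epsilon>/2) \<inter> {0..1})"
      by (simp add: openin_open_Int Int_commute)
    have "openin (prod_topology Y (top_of_set {0..1}))
        ({y \<in> topspace Y. s y \<in> ?N} \<times> (ball t (\<epsilon>/2) \<inter> {0..1}))"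
      using N B by (simp add: openin_prod_Times_iff)
    moreover have "z \<in> {y \<in> topspace Y. s y \<in> ?N} \<times> (ball t (\<epsilon>/2) \<inter> {0..1})"
      using yt y t sK paths e(1) by auto
    moreover have "{y \<in> topspace Y. s y \<in> ?N} \<times> (ball t (\<epsilon>/2) \<inter> {0..1}) \<subseteq> ?P"
      by (auto simp: K_def image_subset_iff)
    ultimately show "\<exists>T. openin (prod_topology Y (top_of_set {0..1})) T \<and> z \<in> T \<and> T \<subseteq> ?P"
      by blast
  qed
qed

text \<open>A section over \<open>U\<close> arises by following the first deformation, then a path chosen for each of the
  finitely many pairs of end points, and then the second deformation backwards. The end points are
  locally constant, since they depend continuously on the pair and lie in a finite subset of a
  Hausdorff space; so the choice of paths does not destroy continuity.\<close>

lemma has_section_on_deformable: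
  assumes pc: "path_connected_space X" and haus: "Hausdorff_space X"
    and F: "finite F"
    and U: "U \<subseteq> topspace X \<times> topspace X"
    and h: "continuous_map (prod_topology (subtopology (prod_topology X X) U) (top_of_set {0..1})) X (\<lambda>(z, t). h z t)"
    and k: "continuous_map (prod_topology (subtopology (prod_topology X X) U) (top_of_set {0..1})) X (\<lambda>(z, t). k z t)"
    and start: "\<And>z. z \<in> U \<Longrightarrow> h z 0 = fst z \<and> k z 0 = snd z"
    and final: "\<And>z. z \<in> U \<Longrightarrow> h z (1::real) \<in> F \<and> k z (1::real) \<in> F"
  shows "has_section_on X U"
proof -
  define Y where "Y = subtopology (prod_topology X X) U"
  let ?I = "top_of_set {0..1::real}"
  have tY: "topspace Y = U" using U by (auto simp: Y_def)
  have h: "continuous_map (prod_topology Y ?I) X (\<lambda>(z, t). h z t)"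
    and k: "continuous_map (prod_topology Y ?I) X (\<lambda>(z, t). k z t)"
    using h k by (simp_all add: Y_def)
  have "\<forall>p q. \<exists>g. p \<in> topspace X \<longrightarrow> q \<in> topspace X \<longrightarrow> pathin X g \<and> g 0 = p \<and> g 1 = q"
    using pc unfolding path_connected_space_def by blast
  then obtain g where g: "\<And>p q. p \<in> topspace X \<Longrightarrow> q \<in> topspace X \<Longrightarrow> pathin X (g p q) \<and> g p q 0 = p \<and> g p q 1 = q"
    by metis
  \<comment> \<open>The times are clamped to \<open>{0..1}\<close> so that each of the three pieces is continuous for all \<open>t\<close>.\<close>
  define H where "H = (\<lambda>z t. if t \<le> 1/3 then h z (min 1 (3 * t))
    else if t \<le> 2/3 then g (h z 1) (k z 1) (max 0 (min 1 (3 * t - 1))) else k z (max 0 (min 1 (3 - 3 * t))))"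
  have cont1: "continuous_map Y X (\<lambda>z. h' z 1)"
    if "continuous_map (prod_topology Y ?I) X (\<lambda>(z, t). h' z t)" for h'
  proof -
    have "continuous_map Y (prod_topology Y ?I) (\<lambda>z. (z, 1))" by (intro continuous_map_pairedI) auto
    from continuous_map_compose[OF this that] show ?thesis by (simp add: o_def)
  qed
  have reparam: "continuous_map (prod_topology Y ?I) X (\<lambda>(z, t). h' z (\<rho> t))"
    if h': "continuous_map (prod_topology Y ?I) X (\<lambda>(z, t). h' z t)" and \<rho>: "continuous_on {0..1} \<rho>" "\<rho> ` {0..1} \<subseteq> {0..1}"
    for h' and \<rho> :: "real \<Rightarrow> real"
  proof -
    have "continuous_map ?I ?I \<rho>" using \<rho> by (auto simp: continuous_map_in_subtopology)
    then have "continuous_map (prod_topology Y ?I) (prod_topology Y ?I) (\<lambda>z. (fst z, \<rho> (snd z)))"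
      by (intro continuous_map_pairedI continuous_map_fst continuous_map_compose[OF continuous_map_snd, unfolded o_def])
    from continuous_map_compose[OF this h'] show ?thesis by (simp add: o_def case_prod_unfold)
  qed
  \<comment> \<open>the open set on which the two deformations end in \<open>p\<close> and \<open>q\<close>\<close>
  define W where "W = (\<lambda>(p, q). {z \<in> U. h z 1 = p \<and> k z 1 = q})"
  have W: "openin Y (W (p, q))" for p q
  proof -
    have 1: "openin Y {z \<in> topspace Y. h' z 1 \<in> topspace X - (F - {p})}"
      if "continuous_map (prod_topology Y ?I) X (\<lambda>(z, t). h' z t)" for h' p
    proof (rule openin_continuous_map_preimage[OF cont1[OF that]])
      have "closedin X ((F - {p}) \<inter> topspace X)"
        using haus F by (simp add: closedin_Hausdorff_finite)
      then have "openin X (topspace X - (F - {p}) \<inter> topspace X)"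
        by (rule openin_diff[OF openin_topspace])
      moreover have "topspace X - (F - {p}) \<inter> topspace X = topspace X - (F - {p})" by auto
      ultimately show "openin X (topspace X - (F - {p}))" by simp
    qed
    have 2: "{z \<in> topspace Y. h' z 1 \<in> topspace X - (F - {p})} = {z \<in> U. h' z 1 = p}"
      if "continuous_map (prod_topology Y ?I) X (\<lambda>(z, t). h' z t)" "\<And>z. z \<in> U \<Longrightarrow> h' z 1 \<in> F" "p \<in> F" for h' p
      using that(2,3) tY continuous_map_image_subset_topspace[OF cont1[OF that(1)]] by auto
    show ?thesis
    proof (cases "p \<in> F \<and> q \<in> F")
      case True
      have "W (p, q) = {z \<in> U. h z 1 = p} \<inter> {z \<in> U. k z 1 = q}" by (auto simp: W_def)
      then show ?thesis using 1[OF h, of p] 1[OF k, of q] 2[OF h, of p] 2[OF k, of q] True final by auto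
    next
      case False
      then have "W (p, q) = {}" using final by (auto simp: W_def)
      then show ?thesis by simp
    qed
  qed
  have "continuous_map (prod_topology Y ?I) X (\<lambda>(z, t). H z t)"
  proof (rule pasting_lemma[where I = "F \<times> F" and T = "\<lambda>w. W w \<times> {0..1}" and f = "\<lambda>_ (z, t). H z t"])
    fix w assume w: "w \<in> F \<times> F"
    obtain p q where pq: "w = (p, q)" by force
    show "openin (prod_topology Y ?I) (W w \<times> {0..1})"
      using W pq openin_topspace[of ?I] by (simp add: openin_prod_Times_iff)
    let ?Z = "subtopology (prod_topology Y ?I) (W w \<times> {0..1})"
    show "continuous_map ?Z X (\<lambda>(z, t). H z t)"
    proof (cases "W w = {}")
      case True
      then show ?thesis by (simp add: continuous_map_on_empty)
    next
      case False
      then obtain z where "z \<in> U" "h z 1 = p" "k z 1 = q" by (auto simp: pq W_def)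
      then have "p \<in> topspace X" "q \<in> topspace X"
        using continuous_map_image_subset_topspace[OF cont1[OF h]] continuous_map_image_subset_topspace[OF cont1[OF k]] tY
        by auto
      then have gpq: "continuous_map ?I X (g p q)" "g p q 0 = p" "g p q 1 = q"
        using g[of p q] by (auto simp: pathin_iff)
      have cg: "continuous_map (prod_topology Y ?I) X (\<lambda>(z, t). g p q t)"
        using continuous_map_compose[OF continuous_map_snd gpq(1)] by (simp add: o_def case_prod_unfold)
      have f1: "continuous_map (prod_topology Y ?I) X (\<lambda>(z, t). h z (min 1 (3 * t)))"
        by (rule reparam[OF h]) (auto intro!: continuous_intros)
      have f2: "continuous_map (prod_topology Y ?I) X (\<lambda>(z, t). g p q (max 0 (min 1 (3 * t - 1))))"
        by (rule reparam[OF cg]) (auto intro!: continuous_intros)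
      have f3: "continuous_map (prod_topology Y ?I) X (\<lambda>(z, t). k z (max 0 (min 1 (3 - 3 * t))))"
        by (rule reparam[OF k]) (auto intro!: continuous_intros)
      have snd: "continuous_map (subtopology (prod_topology Y ?I) S) euclideanreal snd" for S
        using continuous_map_snd[of Y ?I] continuous_map_into_fulltopology
        by (blast intro: continuous_map_from_subtopology)
      have "continuous_map ?Z X (\<lambda>x. if snd x \<le> 1/3 then h (fst x) (min 1 (3 * snd x))
          else if snd x \<le> 2/3 then g p q (max 0 (min 1 (3 * snd x - 1))) else k (fst x) (max 0 (min 1 (3 - 3 * snd x))))"
      proof (intro continuous_map_cases_le)
        fix x assume x: "x \<in> topspace ?Z" and "snd x = 1/3"
        then show "h (fst x) (min 1 (3 * snd x)) =
          (if snd x \<le> 2/3 then g p q (max 0 (min 1 (3 * snd x - 1))) else k (fst x) (max 0 (min 1 (3 - 3 * snd x))))"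
          using gpq by (auto simp: pq W_def)
      next
        fix x assume x: "x \<in> topspace (subtopology ?Z {x. x \<in> topspace ?Z \<and> 1/3 \<le> snd x})" and "snd x = 2/3"
        then show "g p q (max 0 (min 1 (3 * snd x - 1))) = k (fst x) (max 0 (min 1 (3 - 3 * snd x)))"
          using gpq by (auto simp: pq W_def)
      qed (use f1 f2 f3 snd in \<open>auto simp: subtopology_subtopology case_prod_unfold intro: continuous_map_from_subtopology\<close>)
      then show ?thesis
        by (rule continuous_map_eq) (auto simp: H_def W_def pq)
    qed
  next
    fix x assume "x \<in> topspace (prod_topology Y ?I)"
    then show "\<exists>j. j \<in> F \<times> F \<and> x \<in> W j \<times> {0..1} \<and> (\<lambda>(z, t). H z t) x = (\<lambda>(z, t). H z t) x"
      using final[of "fst x"] tY by (intro exI[of _ "(h (fst x) 1, k (fst x) 1)"]) (auto simp: W_def)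
  qed auto
  from continuous_map_into_path_space[OF this]
  have "continuous_map Y (path_space X) (\<lambda>z. restrict (H z) {0..1})" .
  moreover have "path_ends (restrict (H z) {0..1}) = z" if "z \<in> U" for z
    using start[OF that] by (simp add: path_ends_def H_def)
  ultimately show ?thesis unfolding has_section_on_def Y_def by blast
qed

section \<open>Turning numbers\<close>

text \<open>Angles are measured in full turns.\<close>

definition angle :: "(real \<Rightarrow> complex) \<Rightarrow> (real \<Rightarrow> real) \<Rightarrow> bool" where
  "angle p g \<longleftrightarrow> continuous_on {0..1} g \<and> (\<forall>t\<in>{0..1}. p t = cis (2 * pi * g t))"

text \<open>The total change of angle along a path in the circle, not necessarily closed. It is an integer
  for a loop, where it is the winding number.\<close>

definition turn :: "(real \<Rightarrow> complex) \<Rightarrow> real" where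
  "turn p = (THE r. \<exists>g. angle p g \<and> r = g 1 - g 0)"

lemma cis_eq_cis_2pi_iff: "cis (2 * pi * a) = cis (2 * pi * b) \<longleftrightarrow> a - b \<in> \<int>"
proof
  assume "cis (2 * pi * a) = cis (2 * pi * b)"
  then have "cis (2 * pi * a - 2 * pi * b) = 1"
    by (simp flip: cis_divide)
  then have "cos (2 * pi * a - 2 * pi * b) = 1"
    by (metis cis.simps(1) one_complex.simps(1))
  then obtain k :: int where "2 * pi * a - 2 * pi * b = k * 2 * pi"
    using cos_one_2pi_int by auto
  then have "2 * pi * (a - b) = 2 * pi * k" by (simp add: algebra_simps)
  then have "a - b = k" by simp
  then show "a - b \<in> \<int>" by simp
next
  assume "a - b \<in> \<int>"
  then have "cis (2 * pi * (a - b)) = 1" by (rule cis_multiple_2pi)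
  then have "cis (2 * pi * a) / cis (2 * pi * b) = 1"
    by (simp add: cis_divide right_diff_distrib)
  then show "cis (2 * pi * a) = cis (2 * pi * b)" by simp
qed

lemma continuous_Ints_constant:
  fixes f :: "'a::topological_space \<Rightarrow> real"
  assumes "connected S" "continuous_on S f" "\<And>x. x \<in> S \<Longrightarrow> f x \<in> \<int>" "x \<in> S" "y \<in> S"
  shows "f x = f y"
proof -
  have "f constant_on S"
  proof (rule continuous_discrete_range_constant[OF assms(1,2)])
    fix x assume "x \<in> S"
    then have "1 \<le> norm (f y - f x)" if "y \<in> S \<and> f y \<noteq> f x" for y
      using that assms(3) Ints_nonzero_abs_ge1[of "f y - f x"] by (auto simp: Ints_diff)
    then show "\<exists>e>0. \<forall>y. y \<in> S \<and> f y \<noteq> f x \<longrightarrow> e \<le> norm (f y - f x)"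
      by (intro exI[of _ 1]) auto
  qed
  then show ?thesis using assms(4,5) by (auto simp: constant_on_def)
qed

text \<open>Two angle functions of the same path differ by a continuous function with integer values.\<close>

lemma turn_eq:
  assumes "angle p g"
  shows "turn p = g 1 - g 0"
  unfolding turn_def
proof (rule the_equality)
  show "\<exists>h. angle p h \<and> g 1 - g 0 = h 1 - h 0" using assms by blast
  fix r assume "\<exists>h. angle p h \<and> r = h 1 - h 0"
  then obtain h where h: "angle p h" "r = h 1 - h 0" by blast
  have "g 0 - h 0 = g 1 - h 1"
  proof (rule continuous_Ints_constant[where S = "{0..1}" and f = "\<lambda>t. g t - h t"])
    show "continuous_on {0..1} (\<lambda>t. g t - h t)"
      using assms h by (auto simp: angle_def intro!: continuous_intros)
    show "g t - h t \<in> \<int>" if "t \<in> {0..1}" for t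
      using assms h that by (simp add: angle_def flip: cis_eq_cis_2pi_iff)
  qed auto
  then show "r = g 1 - g 0" using h by simp
qed

lemma angle_exists:
  fixes H :: "'a::real_normed_vector \<Rightarrow> complex"
  assumes "continuous_on S H" "contractible S" "\<And>z. z \<in> S \<Longrightarrow> norm (H z) = 1"
  obtains g :: "'a \<Rightarrow> real"
  where "continuous_on S g" "\<And>z. z \<in> S \<Longrightarrow> H z = cis (2 * pi * g z)"
proof -
  obtain l where l: "continuous_on S l" "\<And>z. z \<in> S \<Longrightarrow> H z = exp (l z)"
    using continuous_logarithm_on_contractible[OF assms(1,2)] assms(3) by (metis norm_zero zero_neq_one)
  show thesis
  proof
    show "continuous_on S (\<lambda>z. Im (l z) / (2 * pi))"
      using l(1) by (auto intro!: continuous_intros)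
    fix z assume z: "z \<in> S"
    then have "norm (exp (l z)) = 1" using assms(3) l(2) by simp
    then have "exp (Re (l z)) = 1" by simp
    then show "H z = cis (2 * pi * (Im (l z) / (2 * pi)))"
      using l(2)[OF z] by (simp add: exp_eq_polar)
  qed
qed

text \<open>A map from the square to the circle lifts to the line, so its turning number around the boundary
  vanishes. This replaces homotopy invariance of the degree, and it also applies to homotopies
  that move the ends of a path.\<close>

lemma turn_square:
  assumes H: "continuous_on ({0..1} \<times> {0..1}) (\<lambda>(u, t). H u t)"
    and norm: "\<And>u t. u \<in> {0..1} \<Longrightarrow> t \<in> {0..1} \<Longrightarrow> norm (H u t) = 1"
  shows "turn (H 1) - turn (H 0) = turn (\<lambda>u. H u 1) - turn (\<lambda>u. H u 0)"
proof -
  have "contractible ({0..1} \<times> {0..1} :: (real \<times> real) set)"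
    by (intro convex_imp_contractible convex_Times) auto
  then obtain g where g: "continuous_on ({0..1} \<times> {0..1}) g"
    and Hg: "\<And>z. z \<in> {0..1} \<times> {0..1} \<Longrightarrow> (\<lambda>(u, t). H u t) z = cis (2 * pi * g z)"
    by (rule angle_exists[OF H]) (use norm in auto)
  have col: "angle (H u) (\<lambda>t. g (u, t))" if "u \<in> {0..1}" for u
    unfolding angle_def using that Hg
    by (auto intro!: continuous_intros continuous_on_compose2[OF g])
  have row: "angle (\<lambda>u. H u t) (\<lambda>u. g (u, t))" if "t \<in> {0..1}" for t
    unfolding angle_def using that Hg
    by (auto intro!: continuous_intros continuous_on_compose2[OF g])
  show ?thesis
    using turn_eq[OF col[of 0]] turn_eq[OF col[of 1]] turn_eq[OF row[of 0]] turn_eq[OF row[of 1]]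
    by simp
qed

lemma turn_const: "norm z = 1 \<Longrightarrow> (\<And>t. t \<in> {0..1} \<Longrightarrow> p t = z) \<Longrightarrow> turn p = 0"
proof -
  assume z: "norm z = 1" "\<And>t. t \<in> {0..1} \<Longrightarrow> p t = z"
  have "z = cis (Arg z)" using z by (metis cis_Arg norm_zero sgn_eq zero_neq_one div_by_1 of_real_1)
  then have "angle p (\<lambda>_. Arg z / (2 * pi))"
    using z by (auto simp: angle_def)
  from turn_eq[OF this] show ?thesis by simp
qed

section \<open>A lower bound for the number of sections\<close>

lemma compact_unit_cube: "compact {x :: nat \<Rightarrow> real. \<forall>i. x i \<in> {0..1}}"
proof -
  have "compactin (product_topology (\<lambda>_::nat. euclideanreal) UNIV) (PiE UNIV (\<lambda>_. {0..1}))"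
    by (simp add: compactin_PiE)
  moreover have "PiE UNIV (\<lambda>_. {0..1}) = {x :: nat \<Rightarrow> real. \<forall>i. x i \<in> {0..1}}" by (auto simp: PiE_def)
  ultimately show ?thesis by (simp add: euclidean_product_topology)
qed

lemma dist_fun_le:
  fixes x y :: "nat \<Rightarrow> real"
  assumes "\<And>i. \<bar>x i - y i\<bar> \<le> \<delta>"
  shows "dist x y \<le> 2 * \<delta> + (1/2) ^ N"
proof -
  have "Max {dist (x (from_nat n)) (y (from_nat n)) |n. n \<le> N} \<le> \<delta>"
    using assms by (subst Max_le_iff) (auto simp: dist_real_def)
  then show ?thesis using dist_fun_le_dist_first_terms[of x y N] by linarith
qed

text \<open>Periodicity in the first \<open>m\<close> coordinates reduces the whole space to the unit cube,
  which is compact. A torus of variable dimension \<open>m\<close> is represented by its universal cover inside the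
  metric space of all real sequences.\<close>

lemma periodic_Lebesgue_number:
  fixes \<gamma> :: "(nat \<Rightarrow> real) \<Rightarrow> 'b"
  assumes \<gamma>: "continuous_map euclidean Y \<gamma>"
    and per: "\<And>x y. (\<And>j. j < m \<Longrightarrow> x j - y j \<in> \<int>) \<Longrightarrow> \<gamma> x = \<gamma> y"
    and U: "\<And>i. i < k \<Longrightarrow> openin Y (U i)" "topspace Y \<subseteq> (\<Union>i<k. U i)"
  obtains M :: nat where "M > 0"
    "\<And>x. \<exists>i<k. \<forall>y. (\<forall>j<m. \<bar>y j - x j\<bar> \<le> 1 / M) \<longrightarrow> \<gamma> y \<in> U i"
proof -
  define K where "K = {x :: nat \<Rightarrow> real. \<forall>i. x i \<in> {0..1}}"
  have ope: "open {x. \<gamma> x \<in> U i}" if "i < k" for i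
    using openin_continuous_map_preimage[OF \<gamma> U(1)[OF that]] by simp
  have cov: "K \<subseteq> \<Union>((\<lambda>i. {x. \<gamma> x \<in> U i}) ` {..<k})"
  proof
    fix x assume "x \<in> K"
    have "\<gamma> x \<in> topspace Y" using continuous_map_image_subset_topspace[OF \<gamma>] by auto
    then show "x \<in> \<Union>((\<lambda>i. {x. \<gamma> x \<in> U i}) ` {..<k})" using U(2) by blast
  qed
  obtain \<epsilon> where e: "\<epsilon> > 0"
    "\<And>x. x \<in> K \<Longrightarrow> \<exists>S \<in> (\<lambda>i. {x. \<gamma> x \<in> U i}) ` {..<k}. ball x \<epsilon> \<subseteq> S"
    by (rule Heine_Borel_lemma[OF compact_unit_cube[folded K_def] cov]) (use ope in auto)
  obtain N where N: "(1/2 :: real) ^ N < \<epsilon> / 2"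
    using e(1) real_arch_pow_inv[of "\<epsilon> / 2" "1/2"] by auto
  obtain M :: nat where M: "M > 0" "1 / M < \<epsilon> / 4"
    using e(1) nat_approx_posE[of "\<epsilon> / 4"] by (metis of_nat_Suc zero_less_Suc zero_less_divide_iff zero_less_numeral)
  show thesis
  proof
    fix x :: "nat \<Rightarrow> real"
    \<comment> \<open>Coordinates from \<open>m\<close> on do not affect \<open>\<gamma>\<close>; setting them to \<open>0\<close> makes points close in all coordinates.\<close>
    define x' where "x' = (\<lambda>j. if j < m then frac (x j) else 0)"
    have "x' \<in> K" by (auto simp: K_def x'_def frac_ge_0 less_imp_le[OF frac_lt_1])
    then obtain i where i: "i < k" "ball x' \<epsilon> \<subseteq> {x. \<gamma> x \<in> U i}" using e(2) by blast
    have "\<gamma> y \<in> U i" if y: "\<forall>j<m. \<bar>y j - x j\<bar> \<le> 1 / M" for y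
    proof -
      define y' where "y' = (\<lambda>j. if j < m then x' j + (y j - x j) else 0)"
      have "\<bar>x' j - y' j\<bar> \<le> 1 / M" for j using y by (auto simp: y'_def x'_def abs_minus_commute)
      then have "dist x' y' \<le> 2 * (1 / M) + (1/2) ^ N" by (rule dist_fun_le)
      then have "dist x' y' < \<epsilon>" using N M by linarith
      then have "\<gamma> y' \<in> U i" using i by auto
      moreover have "\<gamma> y' = \<gamma> y"
        by (rule per) (auto simp: y'_def x'_def frac_def)
      ultimately show ?thesis by simp
    qed
    then show "\<exists>i<k. \<forall>y. (\<forall>j<m. \<bar>y j - x j\<bar> \<le> 1 / M) \<longrightarrow> \<gamma> y \<in> U i" using i by blast
  qed (use M in simp)
qed

text \<open>A discrete form of the Poincare-Miranda theorem. The functions \<open>F j\<close> are defined on the grid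
  \<open>{0..p}\<close> in \<open>m\<close> dimensions and change sign between opposite faces; then there is one small cube, with
  lowest corner \<open>q\<close>, on which none of them is constant.\<close>

lemma Kuhn_sign_change:
  fixes F :: "nat \<Rightarrow> (nat \<Rightarrow> nat) \<Rightarrow> real"
  assumes "0 < p"
    and low: "\<And>r j. j < m \<Longrightarrow> r j = 0 \<Longrightarrow> F j r \<le> 0"
    and high: "\<And>r j. j < m \<Longrightarrow> r j = p \<Longrightarrow> F j r > 0"
  obtains q where "\<And>j. j < m \<Longrightarrow> \<exists>r s. (\<forall>i<m. q i \<le> r i \<and> r i \<le> q i + 1) \<and>
      (\<forall>i<m. q i \<le> s i \<and> s i \<le> q i + 1) \<and> F j r \<noteq> F j s"
proof -
  define label where "label = (\<lambda>r j. if F j r > 0 then 1 else 0 :: nat)"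
  obtain q where "\<forall>i<m. q i < p"
    and q: "\<forall>i<m. \<exists>r s. (\<forall>j<m. q j \<le> r j \<and> r j \<le> q j + 1) \<and> (\<forall>j<m. q j \<le> s j \<and> s j \<le> q j + 1) \<and> label r i \<noteq> label s i"
  proof (rule kuhn_lemma[of p m label])
    show "\<forall>x. (\<forall>i<m. x i \<le> p) \<longrightarrow> (\<forall>i<m. x i = 0 \<longrightarrow> label x i = 0)"
    proof (intro allI impI)
      fix x i assume "i < m" "x i = (0::nat)"
      then have "\<not> F i x > 0" using low[of i x] by simp
      then show "label x i = 0" by (simp add: label_def)
    qed
    show "\<forall>x. (\<forall>i<m. x i \<le> p) \<longrightarrow> (\<forall>i<m. x i = p \<longrightarrow> label x i = 1)"
      using high by (simp add: label_def)
  qed (use assms(1) in \<open>auto simp: label_def\<close>)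
  have "\<exists>r s. (\<forall>i<m. q i \<le> r i \<and> r i \<le> q i + 1) \<and> (\<forall>i<m. q i \<le> s i \<and> s i \<le> q i + 1) \<and> F j r \<noteq> F j s"
    if j: "j < m" for j
  proof -
    obtain r s where rs: "\<forall>i<m. q i \<le> r i \<and> r i \<le> q i + 1" "\<forall>i<m. q i \<le> s i \<and> s i \<le> q i + 1" "label r j \<noteq> label s j"
      using q j by blast
    then have "F j r \<noteq> F j s" by (auto simp: label_def)
    then show ?thesis using rs by blast
  qed
  then show thesis using that by blast
qed

text \<open>Here \<open>\<gamma>\<close> is an \<open>m\<close>-torus in \<open>D \<times> D\<close>, and \<open>a j\<close> and \<open>b j\<close> are the angles of the circle-valued function
  \<open>f j\<close> at the two ends of a path that joins the components of a point of the torus. Both depend on the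
  \<open>j\<close>-th coordinate only, and \<open>a j - b j\<close> grows by one turn per period.

  A section over \<open>U i\<close> assigns to each point of the torus over \<open>U i\<close> a path, and \<open>f i\<close> turns by some
  amount \<open>\<theta>\<close> along this path. By \<open>turn_square\<close>, the sum of \<open>\<theta>\<close> and \<open>a i - b i\<close> does not change along a
  segment over \<open>U i\<close>. By the Lebesgue lemma, every cube of a fine grid lies over some \<open>U i\<close>. If there were
  at most \<open>m\<close> sets, every small cube would thus have a coordinate \<open>i\<close> for which this sum is constant on the
  corners of the cube. But \<open>\<theta>\<close> takes only finitely many values on the grid, whereas \<open>a i - b i\<close> grows without
  bound; so on a large cube the sums, shifted by constants, have the signs that \<open>Kuhn_sign_change\<close> requires,
  and this lemma yields a small cube on which none of them is constant.\<close>

theorem number_of_sections_gt: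
  fixes D :: "'b topology" and \<gamma> :: "(nat \<Rightarrow> real) \<Rightarrow> 'b \<times> 'b" and f :: "nat \<Rightarrow> 'b \<Rightarrow> complex"
  assumes \<gamma>: "continuous_map euclidean (prod_topology D D) \<gamma>"
    and per: "\<And>x y. (\<And>j. j < m \<Longrightarrow> x j - y j \<in> \<int>) \<Longrightarrow> \<gamma> x = \<gamma> y"
    and f: "\<And>j. j < m \<Longrightarrow> continuous_map D euclidean (f j)"
      "\<And>j x. j < m \<Longrightarrow> x \<in> topspace D \<Longrightarrow> norm (f j x) = 1"
    and ab: "\<And>j. j < m \<Longrightarrow> continuous_on UNIV (a j)" "\<And>j. j < m \<Longrightarrow> continuous_on UNIV (b j)"
      "\<And>j x. j < m \<Longrightarrow> f j (fst (\<gamma> x)) = cis (2 * pi * a j (x j))"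
      "\<And>j x. j < m \<Longrightarrow> f j (snd (\<gamma> x)) = cis (2 * pi * b j (x j))"
      "\<And>j t. j < m \<Longrightarrow> a j (t + 1) - b j (t + 1) = a j t - b j t + 1"
    and U: "\<And>i. i < k \<Longrightarrow> openin (prod_topology D D) (U i)" "\<And>i. i < k \<Longrightarrow> has_section_on D (U i)"
      "topspace (prod_topology D D) \<subseteq> (\<Union>i<k. U i)"
  shows "m < k"
proof (rule ccontr)
  assume "\<not> m < k"
  then have km: "k \<le> m" by simp
  let ?I = "top_of_set {0..1::real}"
  obtain M :: nat where M: "M > 0"
    "\<And>x. \<exists>i<k. \<forall>y. (\<forall>j<m. \<bar>y j - x j\<bar> \<le> 1 / M) \<longrightarrow> \<gamma> y \<in> U i"
    using periodic_Lebesgue_number[OF \<gamma> per U(1,3)] by blast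
  have "\<forall>i. \<exists>s. i < k \<longrightarrow> continuous_map (subtopology (prod_topology D D) (U i)) (path_space D) s \<and> (\<forall>z\<in>U i. path_ends (s z) = z)"
    using U(2) unfolding has_section_on_def by blast
  then obtain s where s: "\<And>i. i < k \<Longrightarrow> continuous_map (subtopology (prod_topology D D) (U i)) (path_space D) (s i)"
    "\<And>i z. i < k \<Longrightarrow> z \<in> U i \<Longrightarrow> s i z 0 = fst z \<and> s i z 1 = snd z"
    unfolding path_ends_def by (metis fst_conv snd_conv)
  define pt where "pt = (\<lambda>(r :: nat \<Rightarrow> nat) j. if j < m then real (r j) / M else 0)"
  define \<theta> where "\<theta> = (\<lambda>j z. turn (\<lambda>t. f j (s j z t)))"
  \<comment> \<open>Up to periods there are only \<open>M ^ m\<close> grid points, hence \<open>\<theta>\<close> is bounded on the grid without any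
    compactness argument.\<close>
  have fin: "finite ((\<lambda>r. \<gamma> (pt r)) ` UNIV)"
  proof (rule finite_subset)
    show "finite ((\<lambda>r. \<gamma> (pt r)) ` PiE {..<m} (\<lambda>_. {..<M}))"
      by (intro finite_imageI finite_PiE) auto
    show "(\<lambda>r. \<gamma> (pt r)) ` UNIV \<subseteq> (\<lambda>r. \<gamma> (pt r)) ` PiE {..<m} (\<lambda>_. {..<M})"
    proof (intro image_subsetI)
      fix r :: "nat \<Rightarrow> nat"
      define r' where "r' = (\<lambda>j\<in>{..<m}. r j mod M)"
      have "\<gamma> (pt r) = \<gamma> (pt r')"
      proof (rule per)
        fix j assume j: "j < m"
        have "real (r j) = real (r j div M) * M + real (r j mod M)"
          by (metis of_nat_add of_nat_mult div_mult_mod_eq)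
        then have "pt r j - pt r' j = real (r j div M)"
          using j M(1) by (simp add: pt_def r'_def field_simps)
        then show "pt r j - pt r' j \<in> \<int>" by simp
      qed
      moreover have "r' \<in> PiE {..<m} (\<lambda>_. {..<M})" using M(1) by (auto simp: r'_def)
      ultimately show "\<gamma> (pt r) \<in> (\<lambda>r. \<gamma> (pt r)) ` PiE {..<m} (\<lambda>_. {..<M})" by blast
    qed
  qed
  define \<Theta> where "\<Theta> = (\<lambda>(j, z). \<bar>\<theta> j z\<bar>) ` ({..<m} \<times> range (\<lambda>r. \<gamma> (pt r)))"
  have "finite \<Theta>" unfolding \<Theta>_def using fin by auto
  then have "bdd_above \<Theta>" by (rule bdd_above_finite)
  then obtain B0 where B0: "\<And>x. x \<in> \<Theta> \<Longrightarrow> x \<le> B0" by (auto simp: bdd_above_def)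
  obtain B :: nat where "B0 \<le> B" using real_arch_simple by blast
  then have B: "\<bar>\<theta> j (\<gamma> (pt r))\<bar> \<le> B" if "j < m" for j r
    using B0[of "\<bar>\<theta> j (\<gamma> (pt r))\<bar>"] that by (force simp: \<Theta>_def)
  define d where "d = (\<lambda>j t. a j t - b j t)"
  have d: "d j (real l) = d j 0 + l" if "j < m" for j l
    using that by (induction l) (auto simp: d_def ab(5) add.commute[of 1])
  define F where "F = (\<lambda>j r. d j (pt r j) - d j 0 + \<theta> j (\<gamma> (pt r)) - B)"
  \<comment> \<open>\<open>2 * B + 1\<close> periods suffice: the growth of \<open>d j\<close> then exceeds the variation \<open>2 * B\<close> of \<open>\<theta>\<close>.\<close>
  let ?N = "2 * B + 1"
  obtain q where q: "\<And>j. j < m \<Longrightarrow> \<exists>r s. (\<forall>i<m. q i \<le> r i \<and> r i \<le> q i + 1) \<and>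
      (\<forall>i<m. q i \<le> s i \<and> s i \<le> q i + 1) \<and> F j r \<noteq> F j s"
  proof (rule Kuhn_sign_change[of "?N * M" m F])
    show "0 < ?N * M" using M by simp
    fix r :: "nat \<Rightarrow> nat" and j assume j: "j < m"
    show "F j r \<le> 0" if "r j = 0"
      using B[OF j, of r] j that by (simp add: F_def pt_def)
    show "F j r > 0" if "r j = ?N * M"
    proof -
      have "pt r j = real ?N * real M / real M" using that j by (simp only: pt_def of_nat_mult if_True)
      then have "pt r j = real ?N" using M(1) by simp
      then have "F j r = ?N + \<theta> j (\<gamma> (pt r)) - B" using d[OF j, of ?N] by (simp add: F_def)
      then show ?thesis using B[OF j, of r] by simp
    qed
  qed blast
  obtain i where i: "i < k" "\<And>y. (\<forall>j<m. \<bar>y j - pt q j\<bar> \<le> 1 / M) \<Longrightarrow> \<gamma> y \<in> U i"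
    using M(2)[of "pt q"] by blast
  have im: "i < m" using i km by simp
  obtain r r' where r: "\<forall>i<m. q i \<le> r i \<and> r i \<le> q i + 1" and r': "\<forall>i<m. q i \<le> r' i \<and> r' i \<le> q i + 1"
    and neq: "F i r \<noteq> F i r'"
    using q[OF im] by blast
  have near: "\<bar>pt r j - pt q j\<bar> \<le> 1 / M" if "\<forall>i<m. q i \<le> r i \<and> r i \<le> q i + 1" "j < m" for r j
  proof -
    have "\<bar>real (r j) - real (q j)\<bar> \<le> 1" using that by (auto simp: abs_le_iff)
    then have "\<bar>real (r j) - real (q j)\<bar> / M \<le> 1 / M" by (rule divide_right_mono) simp
    then show ?thesis using that(2) by (simp add: pt_def diff_divide_distrib[symmetric])
  qed
  \<comment> \<open>the segment between two corners of the small cube, and the map to the circle over it\<close>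
  define x where "x = (\<lambda>u j. (1 - u) * pt r j + u * pt r' j)"
  have xU: "\<gamma> (x u) \<in> U i" if u: "u \<in> {0..1}" for u
  proof (rule i(2), intro allI impI)
    fix j assume j: "j < m"
    have "x u j \<in> cball (pt q j) (1 / M)"
      unfolding x_def using convexD_alt[of "cball (pt q j) (1 / M)" "pt r j" "pt r' j" u] u near[OF r j] near[OF r' j]
      by (simp add: dist_real_def abs_minus_commute)
    then show "\<bar>x u j - pt q j\<bar> \<le> 1 / M" by (simp add: dist_real_def abs_minus_commute)
  qed
  define H where "H = (\<lambda>u t. f i (s i (\<gamma> (x u)) t))"
  have cx: "continuous_on UNIV x"
    unfolding x_def by (intro continuous_on_coordinatewise_then_product continuous_intros)
  have "continuous_map ?I (prod_topology D D) (\<lambda>u. \<gamma> (x u))"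
    using continuous_map_compose[OF _ \<gamma>, of ?I x] continuous_on_subset[OF cx] by (simp add: o_def)
  then have "continuous_map ?I (subtopology (prod_topology D D) (U i)) (\<lambda>u. \<gamma> (x u))"
    using xU by (auto simp: continuous_map_in_subtopology)
  from continuous_map_compose[OF this s(1)[OF i(1)]]
  have "continuous_map (prod_topology ?I ?I) D (\<lambda>(u, t). (s i \<circ> (\<lambda>u. \<gamma> (x u))) u t)"
    by (rule continuous_map_from_path_space)
  then have sD: "continuous_map (top_of_set ({0..1} \<times> {0..1})) D (\<lambda>(u, t). s i (\<gamma> (x u)) t)"
    by (simp add: o_def)
  from continuous_map_compose[OF this f(1)[OF im]]
  have cont: "continuous_on ({0..1} \<times> {0..1}) (\<lambda>(u, t). H u t)"
    by (simp add: o_def H_def case_prod_unfold)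
  have norm: "norm (H u t) = 1" if "u \<in> {0..1}" "t \<in> {0..1}" for u t
    using continuous_map_image_subset_topspace[OF sD] that unfolding H_def by (intro f(2)[OF im]) force
  have xi: "continuous_on {0..1} (\<lambda>u. x u i)" unfolding x_def by (intro continuous_intros)
  have "angle (\<lambda>u. H u 0) (\<lambda>u. a i (x u i))"
    using ab(3)[OF im] s(2)[OF i(1) xU] continuous_on_compose2[OF ab(1)[OF im] xi] by (simp add: angle_def H_def)
  then have 0: "turn (\<lambda>u. H u 0) = a i (pt r' i) - a i (pt r i)" by (simp add: turn_eq x_def)
  have "angle (\<lambda>u. H u 1) (\<lambda>u. b i (x u i))"
    using ab(4)[OF im] s(2)[OF i(1) xU] continuous_on_compose2[OF ab(2)[OF im] xi] by (simp add: angle_def H_def)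
  then have 1: "turn (\<lambda>u. H u 1) = b i (pt r' i) - b i (pt r i)" by (simp add: turn_eq x_def)
  have "x 0 = pt r" "x 1 = pt r'" by (auto simp: x_def)
  then have "turn (H 0) = \<theta> i (\<gamma> (pt r))" "turn (H 1) = \<theta> i (\<gamma> (pt r'))" by (simp_all add: H_def \<theta>_def)
  then have "F i r = F i r'"
    using turn_square[OF cont norm] 0 1 by (simp add: F_def d_def)
  then show False using neq by simp
qed

section \<open>Cells of a graph\<close>

locale graph_space =
  fixes G :: "('a, 'e) graph"
  assumes graph: "is_graph G"
begin

abbreviation "X \<equiv> carrier_top G"
abbreviation "char \<equiv> char_map G"

lemma Hausdorff_X: "Hausdorff_space X"
  and connected_X: "connected_space X"
  and finite_verts: "finite (verts G)"
  and finite_edges: "finite (edges G)"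
  and topspace_X: "topspace X = verts G \<union> (\<Union>e\<in>edges G. open_edge G e)"
  using graph by (auto simp: is_graph_def)

lemma char_continuous: "e \<in> edges G \<Longrightarrow> continuous_map (top_of_set {0..1}) X (char e)"
  and char_0: "e \<in> edges G \<Longrightarrow> char e 0 \<in> verts G"
  and char_1: "e \<in> edges G \<Longrightarrow> char e 1 \<in> verts G"
  and open_edge_verts: "e \<in> edges G \<Longrightarrow> open_edge G e \<inter> verts G = {}"
  using graph by (auto simp: is_graph_def)

lemma char_topspace: "e \<in> edges G \<Longrightarrow> t \<in> {0..1} \<Longrightarrow> char e t \<in> topspace X"
  using char_continuous by (fastforce simp: continuous_map_def)

lemma verts_topspace: "v \<in> verts G \<Longrightarrow> v \<in> topspace X"
  by (simp add: topspace_X)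

lemma char_notin_verts: "e \<in> edges G \<Longrightarrow> 0 < t \<Longrightarrow> t < 1 \<Longrightarrow> char e t \<notin> verts G"
  using open_edge_verts[of e] by (force simp: open_edge_def)

lemma char_in_open_edge: "0 < t \<Longrightarrow> t < 1 \<Longrightarrow> char e t \<in> open_edge G e"
  by (simp add: open_edge_def)

lemma open_edge_unique:
  "e \<in> edges G \<Longrightarrow> e' \<in> edges G \<Longrightarrow> x \<in> open_edge G e \<Longrightarrow> x \<in> open_edge G e' \<Longrightarrow> e = e'"
  using graph by (auto simp: is_graph_def disjoint_family_on_def)

lemma char_inj:
  assumes "e \<in> edges G" "e' \<in> edges G" "0 < t" "t < 1" "0 < t'" "t' < 1" "char e t = char e' t'"
  shows "e = e' \<and> t = t'"
proof -
  have e: "e = e'"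
    using open_edge_unique[of e e' "char e t"] char_in_open_edge[of t e] char_in_open_edge[of t' e'] assms
    by simp
  have "embedding_map (top_of_set {0<..<1}) X (char e)"
    using graph assms(1) by (auto simp: is_graph_def)
  then have "inj_on (char e) {0<..<1}"
    unfolding embedding_map_def using homeomorphic_imp_injective_map by fastforce
  then show ?thesis using assms e by (auto dest: inj_onD)
qed

lemma point_cases:
  assumes "x \<in> topspace X"
  obtains "x \<in> verts G" | e t where "e \<in> edges G" "0 < t" "t < 1" "x = char e t"
  using assms that by (auto simp: topspace_X open_edge_def)

text \<open>The image of \<open>{0..1}\<close> is compact, hence closed in the Hausdorff space \<open>X\<close>.\<close>

lemma closed_edge_eq:
  assumes e: "e \<in> edges G" shows "closed_edge G e = char e ` {0..1}"
proof
  have "compactin X (char e ` {0..1})"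
    using char_continuous[OF e] by (intro image_compactin[of "top_of_set {0..1}"]) auto
  then have "closedin X (char e ` {0..1})"
    using Hausdorff_X compactin_imp_closedin by blast
  moreover have "open_edge G e \<subseteq> char e ` {0..1}" by (auto simp: open_edge_def)
  ultimately show "closed_edge G e \<subseteq> char e ` {0..1}"
    unfolding closed_edge_def using closure_of_minimal by blast
  have "top_of_set {0..1} closure_of {0<..<1} = {0..1::real}"
  proof -
    have "{0..1} \<inter> {0<..<1} = {0<..<1::real}" by auto
    then show ?thesis by (simp add: closure_of_subtopology)
  qed
  then show "char e ` {0..1} \<subseteq> closed_edge G e"
    using continuous_map_image_closure_subset[OF char_continuous[OF e], of "{0<..<1}"]
    by (simp add: closed_edge_def open_edge_def)
qed

lemma closedin_closed_edge: "closedin X (closed_edge G e)"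
  by (simp add: closed_edge_def)

text \<open>Values \<open>A v\<close> at the vertices and \<open>B e t\<close> at the points with parameter \<open>t\<close> of the open edges. The
  parameter is unique by \<open>char_inj\<close>. All functions on the graph that occur below have this form.\<close>

definition edgewise :: "('a \<Rightarrow> 'b) \<Rightarrow> ('e \<Rightarrow> real \<Rightarrow> 'b) \<Rightarrow> 'a \<Rightarrow> 'b" where
  "edgewise A B x = (if x \<in> verts G then A x else
     let p = (SOME p. fst p \<in> edges G \<and> 0 < snd p \<and> snd p < 1 \<and> x = char (fst p) (snd p))
     in B (fst p) (snd p))"

lemma edgewise_vert [simp]: "v \<in> verts G \<Longrightarrow> edgewise A B v = A v"
  by (simp add: edgewise_def)

lemma edgewise_char:
  assumes "e \<in> edges G" "0 < t" "t < 1" shows "edgewise A B (char e t) = B e t"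
proof -
  define p where "p = (SOME p. fst p \<in> edges G \<and> 0 < snd p \<and> snd p < 1 \<and> char e t = char (fst p) (snd p))"
  have "fst p \<in> edges G \<and> 0 < snd p \<and> snd p < 1 \<and> char e t = char (fst p) (snd p)"
    unfolding p_def by (rule someI[of _ "(e, t)"]) (use assms in auto)
  then have "fst p = e" "snd p = t" using char_inj assms by metis+
  then show ?thesis using char_notin_verts[OF assms] by (simp add: edgewise_def p_def)
qed

lemma edgewise_char_closed:
  assumes "e \<in> edges G" "t \<in> {0..1}" "A (char e 0) = B e 0" "A (char e 1) = B e 1"
  shows "edgewise A B (char e t) = B e t"
proof -
  consider "t = 0" | "t = 1" | "0 < t" "t < 1" using assms(2) by fastforce
  then show ?thesis
    using assms char_0 char_1 by cases (auto simp: edgewise_char)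
qed

text \<open>Continuity may be checked edge by edge: a graph is a finite union of closed edges and vertices,
  and a closed edge is a quotient of the interval, because a map from a compact space to a Hausdorff
  space is closed. The same holds for the product with an interval, so the statement covers
  homotopies. An open set is saturated, which allows the restriction to \<open>S\<close>.\<close>

lemma continuous_map_on_edges_param:
  fixes S :: "('a \<times> real) set"
  assumes S: "openin (prod_topology X (top_of_set {0..1})) S"
    and edge: "\<And>e. e \<in> edges G \<Longrightarrow>
      continuous_map (top_of_set {z \<in> {0..1} \<times> {0..1}. (char e (fst z), snd z) \<in> S}) Z
        (\<lambda>z. f (char e (fst z), snd z))"
    and vert: "\<And>v. v \<in> verts G \<Longrightarrow> continuous_map (top_of_set {u \<in> {0..1}. (v, u) \<in> S}) Z (\<lambda>u. f (v, u))"
  shows "continuous_map (subtopology (prod_topology X (top_of_set {0..1})) S) Z f"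
proof -
  let ?I = "top_of_set {0..1::real}"
  let ?Y = "subtopology (prod_topology X ?I) S"
  let ?J = "Inl ` verts G \<union> Inr ` edges G :: ('a + 'e) set"
  define T where "T = case_sum (\<lambda>v. {v}) (closed_edge G)"
  have T_closed: "closedin X (T i)" if "i \<in> ?J" for i
    using that Hausdorff_X verts_topspace by (auto simp: T_def closedin_closed_edge closedin_Hausdorff_singleton)
  have Ssub: "S \<subseteq> topspace X \<times> {0..1}" using openin_subset[OF S] by simp
  have cont: "continuous_map (subtopology ?Y (T i \<times> {0..1})) Z f" if "i \<in> ?J" for i
  proof (cases i)
    case (Inl v)
    then have v: "v \<in> verts G" using that by auto
    have "continuous_map (subtopology ?Y (T i \<times> {0..1})) (top_of_set {u \<in> {0..1}. (v, u) \<in> S}) snd"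
      unfolding continuous_map_in_subtopology
    proof
      show "continuous_map (subtopology ?Y (T i \<times> {0..1})) euclideanreal snd"
        using continuous_map_snd[of X ?I] continuous_map_into_fulltopology
        by (blast intro: continuous_map_from_subtopology)
    qed (auto simp: Inl T_def)
    from continuous_map_compose[OF this vert[OF v]] show ?thesis
      by (rule continuous_map_eq) (auto simp: Inl T_def)
  next
    case (Inr e)
    then have e: "e \<in> edges G" using that by auto
    let ?C = "T i \<times> {0..1::real}"
    define \<phi> where "\<phi> = (\<lambda>z::real \<times> real. (char e (fst z), snd z))"
    have "continuous_map (prod_topology ?I ?I) (prod_topology X ?I) \<phi>"
      unfolding \<phi>_def
      by (intro continuous_map_pairedI continuous_map_snd continuous_map_compose[OF continuous_map_fst char_continuous[OF e], unfolded o_def])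
    then have c\<phi>: "continuous_map (prod_topology ?I ?I) (subtopology (prod_topology X ?I) ?C) \<phi>"
      by (auto simp: continuous_map_in_subtopology Inr T_def \<phi>_def closed_edge_eq[OF e])
    have "compact_space (prod_topology ?I ?I)"
      using compact_space_prod_topology[of ?I ?I] by (simp add: compact_space_subtopology)
    moreover have "Hausdorff_space (subtopology (prod_topology X ?I) ?C)"
      by (intro Hausdorff_space_subtopology) (simp add: Hausdorff_space_prod_topology Hausdorff_X Hausdorff_space_subtopology)
    ultimately have "closed_map (prod_topology ?I ?I) (subtopology (prod_topology X ?I) ?C) \<phi>"
      using c\<phi> continuous_imp_closed_map by blast
    moreover have "\<phi> ` topspace (prod_topology ?I ?I) = topspace (subtopology (prod_topology X ?I) ?C)"
      using closedin_subset[OF closedin_closed_edge[of e]] by (force simp: Inr T_def \<phi>_def closed_edge_eq[OF e])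
    ultimately have q: "quotient_map (prod_topology ?I ?I) (subtopology (prod_topology X ?I) ?C) \<phi>"
      using c\<phi> continuous_closed_imp_quotient_map by blast
    let ?U = "{z \<in> topspace (prod_topology ?I ?I). \<phi> z \<in> ?C \<inter> S}"
    have "quotient_map (subtopology (prod_topology ?I ?I) ?U)
        (subtopology (subtopology (prod_topology X ?I) ?C) (?C \<inter> S)) \<phi>"
      using S by (intro quotient_map_restriction[OF q]) (auto intro: openin_subtopology_Int2)
    moreover have "subtopology (subtopology (prod_topology X ?I) ?C) (?C \<inter> S) = subtopology ?Y ?C"
      by (simp add: subtopology_subtopology Int_commute Int_left_commute Int_assoc[symmetric])
    moreover have "?U = {z \<in> {0..1} \<times> {0..1}. (char e (fst z), snd z) \<in> S}"
      by (auto simp: \<phi>_def Inr T_def closed_edge_eq[OF e])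
    ultimately have q': "quotient_map (top_of_set {z \<in> {0..1} \<times> {0..1}. (char e (fst z), snd z) \<in> S}) (subtopology ?Y ?C) \<phi>"
      by (simp add: subtopology_subtopology Int_absorb1 Collect_restrict)
    show ?thesis
      using edge[OF e] by (intro continuous_compose_quotient_map[OF q']) (simp add: o_def \<phi>_def)
  qed
  show ?thesis
  proof (rule pasting_lemma_closed[where I = ?J and T = "\<lambda>i. S \<inter> (T i \<times> {0..1})" and f = "\<lambda>_. f"])
    show "finite ?J" using finite_verts finite_edges by simp
    show "closedin ?Y (S \<inter> (T i \<times> {0..1}))" if "i \<in> ?J" for i
      using T_closed[OF that] by (intro closedin_subtopology_Int_closed) (simp add: closedin_prod_Times_iff)
    show "continuous_map (subtopology ?Y (S \<inter> (T i \<times> {0..1}))) Z f" if "i \<in> ?J" for i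
      using cont[OF that] by (simp add: subtopology_subtopology)
    show "\<exists>j. j \<in> ?J \<and> x \<in> S \<inter> (T j \<times> {0..1}) \<and> f x = f x" if "x \<in> topspace ?Y" for x
    proof -
      have x: "x \<in> S" "fst x \<in> topspace X" "snd x \<in> {0..1}" using that by auto
      from x(2) have "\<exists>j\<in>?J. fst x \<in> T j"
      proof (cases rule: point_cases)
        case 1 then show ?thesis by (intro bexI[of _ "Inl (fst x)"]) (auto simp: T_def)
      next
        case (2 e t) then show ?thesis
          by (intro bexI[of _ "Inr e"]) (auto simp: T_def closed_edge_eq)
      qed
      then show ?thesis using x by (metis IntI SigmaI prod.collapse)
    qed
  qed auto
qed

lemma continuous_map_on_edges:
  assumes edge: "\<And>e. e \<in> edges G \<Longrightarrow> continuous_map (top_of_set {0..1}) Z (\<lambda>t. f (char e t))"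
    and vert: "\<And>v. v \<in> verts G \<Longrightarrow> f v \<in> topspace Z"
  shows "continuous_map X Z f"
proof -
  let ?I = "top_of_set {0..1::real}"
  have "continuous_map (subtopology (prod_topology X ?I) (topspace X \<times> {0..1})) Z (\<lambda>z. f (fst z))"
  proof (rule continuous_map_on_edges_param)
    show "openin (prod_topology X ?I) (topspace X \<times> {0..1})"
      using openin_topspace[of "prod_topology X ?I"] by simp
    fix e assume e: "e \<in> edges G"
    have "continuous_map (prod_topology ?I ?I) Z ((\<lambda>t. f (char e t)) \<circ> fst)"
      by (rule continuous_map_compose[OF continuous_map_fst edge[OF e]])
    then have "continuous_map (prod_topology ?I ?I) Z (\<lambda>z. f (char e (fst z)))"
      by (simp add: o_def)
    then have "continuous_map (top_of_set ({0..1} \<times> {0..1::real})) Z (\<lambda>z. f (char e (fst z)))"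
      by (simp add: prod_topology_subtopology_eu)
    then show "continuous_map (top_of_set {z \<in> {0..1} \<times> {0..1::real}. (char e (fst z), snd z) \<in> topspace X \<times> {0..1}}) Z
        (\<lambda>z. f (fst (char e (fst z), snd z)))"
      unfolding fst_conv by (rule continuous_map_from_subtopology_mono) auto
  qed (use vert in auto)
  then have c: "continuous_map (prod_topology X ?I) Z (\<lambda>z. f (fst z))"
    using subtopology_topspace[of "prod_topology X ?I"] by simp
  have "continuous_map X (prod_topology X ?I) (\<lambda>x. (x, 0))"
    by (intro continuous_map_pairedI) auto
  from continuous_map_compose[OF this c] show ?thesis by (simp add: o_def)
qed

section \<open>Corners and configurations\<close>

text \<open>The vertices of the closed cell around a point.\<close>

definition corners :: "'a \<Rightarrow> 'a set" where
  "corners = edgewise (\<lambda>v. {v}) (\<lambda>e t. {char e 0, char e 1})"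

lemma corners_vert [simp]: "v \<in> verts G \<Longrightarrow> corners v = {v}"
  by (simp add: corners_def)

lemma corners_char: "e \<in> edges G \<Longrightarrow> 0 < t \<Longrightarrow> t < 1 \<Longrightarrow> corners (char e t) = {char e 0, char e 1}"
  by (simp add: corners_def edgewise_char)

lemma corners_char_subset: "e \<in> edges G \<Longrightarrow> t \<in> {0..1} \<Longrightarrow> corners (char e t) \<subseteq> {char e 0, char e 1}"
  using corners_char[of e t] char_0[of e] char_1[of e] by (cases "t = 0"; cases "t = 1") auto

lemma corners_nonempty: "x \<in> topspace X \<Longrightarrow> corners x \<noteq> {}"
  by (erule point_cases) (auto simp: corners_char)

lemma closure_of_cell:
  assumes "c \<in> cells G" "x \<in> c" shows "x \<in> topspace X" "X closure_of c = corners x \<union> (c - verts G)"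
proof -
  consider v where "v \<in> verts G" "c = {v}" | e where "e \<in> edges G" "c = open_edge G e"
    using assms(1) by (auto simp: cells_def)
  then have "x \<in> topspace X \<and> X closure_of c = corners x \<union> (c - verts G)"
  proof cases
    case 1
    then have "X closure_of {v} = {v}"
      using Hausdorff_X verts_topspace closedin_Hausdorff_singleton closure_of_eq by metis
    then show ?thesis using 1 assms verts_topspace by auto
  next
    case 2
    then obtain t where t: "0 < t" "t < 1" "x = char e t" using assms(2) by (auto simp: open_edge_def)
    have "{0..1} = {0, 1} \<union> {0<..<1::real}" by auto
    then have "closed_edge G e = {char e 0, char e 1} \<union> open_edge G e"
      using closed_edge_eq[OF 2(1)] by (simp add: open_edge_def image_Un)
    then show ?thesis
      using 2 t open_edge_verts[of e] char_topspace[of e t] by (auto simp: corners_char closed_edge_def)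
  qed
  then show "x \<in> topspace X" "X closure_of c = corners x \<union> (c - verts G)" by auto
qed

lemma corners_verts: "x \<in> topspace X \<Longrightarrow> corners x \<subseteq> verts G"
  by (erule point_cases) (auto simp: corners_char char_0 char_1)

text \<open>Two different cells can only meet in vertices after taking closures, and a cell shares its corners
  with itself; so disjointness of closed cells is disjointness of corners.\<close>

lemma disjoint_closures_iff:
  assumes c: "c \<in> cells G" "x \<in> c" and d: "d \<in> cells G" "y \<in> d"
  shows "X closure_of c \<inter> X closure_of d = {} \<longleftrightarrow> corners x \<inter> corners y = {}"
proof
  show "X closure_of c \<inter> X closure_of d = {} \<Longrightarrow> corners x \<inter> corners y = {}"
    using closure_of_cell[OF c] closure_of_cell[OF d] by auto
  assume disj: "corners x \<inter> corners y = {}"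
  have "c = d" if "z \<in> c" "z \<in> d" "z \<notin> verts G" for z
    using that c d open_edge_unique by (fastforce simp: cells_def)
  moreover have "corners x = corners y" if "c = d" "z \<in> c" "z \<notin> verts G" for z
    using that c d by (auto simp: cells_def open_edge_def corners_char)
  ultimately have "z \<notin> c \<or> z \<notin> d" if "z \<notin> verts G" for z
    using that disj corners_nonempty[OF closure_of_cell(1)[OF c]] by (metis Int_absorb)
  then show "X closure_of c \<inter> X closure_of d = {}"
    using closure_of_cell[OF c] closure_of_cell[OF d] disj corners_verts by blast
qed

definition confs :: "nat \<Rightarrow> (nat \<Rightarrow> 'a) set" where
  "confs n = {x \<in> {..<n} \<rightarrow>\<^sub>E topspace X. \<forall>i<n. \<forall>j<n. i \<noteq> j \<longrightarrow> corners (x i) \<inter> corners (x j) = {}}"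

text \<open>This description of the underlying set no longer mentions cells. In it a configuration stays one
  when its points move in such a way that their corners do not grow.\<close>

lemma disc_conf_eq: "disc_conf n G = subtopology (product_topology (\<lambda>_. X) {..<n}) (confs n)"
proof -
  have cell: "\<exists>c\<in>cells G. x \<in> c" if "x \<in> topspace X" for x
    using that by (auto simp: topspace_X cells_def)
  define P where "P = (\<lambda>c. (\<forall>i<n. c i \<in> cells G) \<and>
    (\<forall>i<n. \<forall>j<n. i \<noteq> j \<longrightarrow> (X closure_of c i) \<inter> (X closure_of c j) = {}))"
  have "\<Union>{PiE {..<n} c | c. P c} = confs n"
  proof (intro equalityI subsetI)
    fix x assume "x \<in> \<Union>{PiE {..<n} c | c. P c}"
    then obtain c where x: "x \<in> PiE {..<n} c" and P: "P c" by auto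
    have c: "c i \<in> cells G" "x i \<in> c i" if "i < n" for i using P x that by (auto simp: P_def)
    have "x i \<in> topspace X" if "i < n" for i
      using closure_of_cell(1)[OF c[OF that]] .
    moreover have "corners (x i) \<inter> corners (x j) = {}" if "i < n" "j < n" "i \<noteq> j" for i j
      using disjoint_closures_iff[OF c[OF that(1)] c[OF that(2)]] P that by (simp add: P_def)
    ultimately show "x \<in> confs n" using x by (auto simp: confs_def PiE_iff)
  next
    fix x assume x: "x \<in> confs n"
    then have "x i \<in> topspace X" if "i < n" for i using that by (auto simp: confs_def)
    then have "\<forall>i<n. \<exists>c. c \<in> cells G \<and> x i \<in> c" using cell by (simp flip: Bex_def)
    then obtain c where c: "\<And>i. i < n \<Longrightarrow> c i \<in> cells G" "\<And>i. i < n \<Longrightarrow> x i \<in> c i" by metis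
    have "(X closure_of c i) \<inter> (X closure_of c j) = {}" if "i < n" "j < n" "i \<noteq> j" for i j
      using disjoint_closures_iff[OF c(1)[OF that(1)] c(2)[OF that(1)] c(1)[OF that(2)] c(2)[OF that(2)]] x that
      by (simp add: confs_def)
    then have "P c" using c(1) by (simp add: P_def)
    moreover have "x \<in> PiE {..<n} c" using x c by (auto simp: confs_def PiE_iff)
    ultimately show "x \<in> \<Union>{PiE {..<n} c | c. P c}" by auto
  qed
  then show ?thesis by (simp add: disc_conf_def P_def)
qed

lemma confs_topspace: "x \<in> confs n \<Longrightarrow> i < n \<Longrightarrow> x i \<in> topspace X"
  by (auto simp: confs_def)

lemma topspace_disc_conf: "topspace (disc_conf n G) = confs n"
  by (auto simp: disc_conf_eq confs_def)

lemma continuous_map_disc_conf: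
  assumes "\<And>i. i < n \<Longrightarrow> continuous_map Y X (\<lambda>y. f y i)"
    and "\<And>y. y \<in> topspace Y \<Longrightarrow> f y \<in> extensional {..<n}"
    and "\<And>y i j. y \<in> topspace Y \<Longrightarrow> i < n \<Longrightarrow> j < n \<Longrightarrow> i \<noteq> j \<Longrightarrow> corners (f y i) \<inter> corners (f y j) = {}"
  shows "continuous_map Y (disc_conf n G) f"
  unfolding disc_conf_eq continuous_map_in_subtopology continuous_map_componentwise
  using assms continuous_map_image_subset_topspace[OF assms(1)]
  by (auto simp: confs_def PiE_iff image_subset_iff)

lemma continuous_map_disc_conf_coord: "i < n \<Longrightarrow> continuous_map (disc_conf n G) X (\<lambda>x. x i)"
  unfolding disc_conf_eq by (intro continuous_map_from_subtopology continuous_map_product_projection) auto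

end

section \<open>Domains of continuity for a motion planner\<close>

text \<open>The value is \<open>0\<close> for \<open>t < \<tau>\<close>, \<open>1/2\<close> for \<open>\<tau> < t < 1 - \<tau>\<close>, and \<open>1\<close> for \<open>t > 1 - \<tau>\<close>, where \<open>\<tau> < 1/2\<close>.
  The formula with \<open>sgn\<close> makes continuity away from the two jumps immediate.\<close>

definition target :: "real \<Rightarrow> real \<Rightarrow> real" where
  "target \<tau> t = 1/2 + (sgn (t - \<tau>) + sgn (t - (1 - \<tau>))) / 4"

lemma target_range: "target \<tau> t \<in> {0..1}"
  by (auto simp: target_def sgn_if)

lemma target_values:
  assumes "t \<noteq> \<tau>" "t \<noteq> 1 - \<tau>" "\<tau> < 1/2" shows "target \<tau> t \<in> {0, 1/2, 1}"
  using assms by (auto simp: target_def sgn_if)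

lemma target_ends: "0 < \<tau> \<Longrightarrow> \<tau> < 1/2 \<Longrightarrow> target \<tau> 0 = 0" "0 < \<tau> \<Longrightarrow> \<tau> < 1/2 \<Longrightarrow> target \<tau> 1 = 1"
  by (auto simp: target_def sgn_if)

lemma convex_unit: "t \<in> {0..1} \<Longrightarrow> s \<in> {0..1} \<Longrightarrow> b \<in> {0..1} \<Longrightarrow> (1 - s) * t + s * b \<in> {0..1::real}"
  using convexD_alt[of "{0..1::real}" t b s] by auto

context graph_space begin

definition height :: "'a \<Rightarrow> real" where
  "height = edgewise (\<lambda>_. 0) (\<lambda>_ t. min t (1 - t))"

lemma height_char: "e \<in> edges G \<Longrightarrow> t \<in> {0..1} \<Longrightarrow> height (char e t) = min t (1 - t)"
  unfolding height_def by (subst edgewise_char_closed) auto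

lemma height_continuous: "continuous_map X euclideanreal height"
proof (rule continuous_map_on_edges)
  fix e assume e: "e \<in> edges G"
  have "continuous_map (top_of_set {0..1}) euclideanreal (\<lambda>t. min t (1 - t))"
    by (auto intro!: continuous_intros)
  then show "continuous_map (top_of_set {0..1}) euclideanreal (\<lambda>t. height (char e t))"
    by (rule continuous_map_eq) (use e in \<open>auto simp: height_char\<close>)
qed auto

definition slide :: "real \<Rightarrow> real \<Rightarrow> 'a \<Rightarrow> 'a" where
  "slide \<tau> s = edgewise (\<lambda>v. v) (\<lambda>e t. char e ((1 - s) * t + s * target \<tau> t))"

text \<open>At the ends of an edge the sliding map fixes the vertex; so the formula for open edges extends to
  closed ones.\<close>

lemma slide_char:
  assumes "0 < \<tau>" "\<tau> < 1/2" "e \<in> edges G" "t \<in> {0..1}"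
  shows "slide \<tau> s (char e t) = char e ((1 - s) * t + s * target \<tau> t)"
  unfolding slide_def using assms by (subst edgewise_char_closed) (auto simp: target_ends)

lemma slide_0: "x \<in> topspace X \<Longrightarrow> slide \<tau> 0 x = x"
  by (erule point_cases) (auto simp: slide_def edgewise_char)

text \<open>A point slides inside its closed cell, so sliding preserves configurations.\<close>

lemma slide_corners: 
  assumes "x \<in> topspace X" "s \<in> {0..1}" shows "corners (slide \<tau> s x) \<subseteq> corners x"
  using assms(1)
proof (cases rule: point_cases)
  case (2 e t)
  have "(1 - s) * t + s * target \<tau> t \<in> {0..1}"
    using 2 assms(2) by (intro convex_unit target_range) auto
  from corners_char_subset[OF 2(1) this] show ?thesis
    using 2 by (simp add: slide_def edgewise_char corners_char)
qed (simp add: slide_def)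

lemma slide_1:
  assumes "x \<in> topspace X" "0 < \<tau>" "\<tau> < 1/2" "height x \<noteq> \<tau>"
  shows "slide \<tau> 1 x \<in> verts G \<union> (\<lambda>e. char e (1/2)) ` edges G"
  using assms(1)
proof (cases rule: point_cases)
  case (2 e t)
  then have "target \<tau> t \<in> {0, 1/2, 1}"
    using assms by (intro target_values) (auto simp: height_char min_def split: if_splits)
  then consider "target \<tau> t = 0" | "target \<tau> t = 1/2" | "target \<tau> t = 1" by blast
  moreover have "slide \<tau> 1 x = char e (target \<tau> t)" using 2 assms by (simp add: slide_char)
  ultimately show ?thesis using 2(1) char_0[of e] char_1[of e] by cases auto
qed (simp add: slide_def)

text \<open>The target of a point with parameter \<open>t\<close> jumps only at \<open>t = \<tau>\<close> and at \<open>t = 1 - \<tau>\<close>,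
  that is at height \<open>\<tau>\<close>.\<close>

lemma slide_continuous:
  assumes \<tau>: "0 < \<tau>" "\<tau> < 1/2"
  shows "continuous_map (prod_topology (subtopology X {x. height x \<noteq> \<tau>}) (top_of_set {0..1})) X (\<lambda>(x, s). slide \<tau> s x)"
proof -
  let ?I = "top_of_set {0..1::real}"
  let ?O = "{x \<in> topspace X. height x \<in> - {\<tau>}}"
  have O: "openin X ?O" by (rule openin_continuous_map_preimage[OF height_continuous]) auto
  have "continuous_map (subtopology (prod_topology X ?I) (?O \<times> {0..1})) X (\<lambda>(x, s). slide \<tau> s x)"
  proof (rule continuous_map_on_edges_param)
    show "openin (prod_topology X ?I) (?O \<times> {0..1})"
      using O openin_topspace[of ?I] by (simp add: openin_prod_Times_iff)
    fix e assume e: "e \<in> edges G"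
    let ?S = "{z \<in> {0..1} \<times> {0..1}. (char e (fst z), snd z) \<in> ?O \<times> {0..1}}"
    let ?r = "\<lambda>z. (1 - snd z) * fst z + snd z * target \<tau> (fst z)"
    have "fst z - \<tau> \<noteq> 0 \<and> fst z - (1 - \<tau>) \<noteq> 0" if "z \<in> ?S" for z
      using that \<tau> height_char[OF e, of "fst z"] by (auto simp: min_def split: if_splits)
    then have ne: "\<forall>z\<in>?S. fst z - \<tau> \<noteq> 0" "\<forall>z\<in>?S. fst z - (1 - \<tau>) \<noteq> 0" by blast+
    have "continuous_on ?S ?r"
      unfolding target_def by (intro continuous_intros ne) auto
    moreover have "?r ` ?S \<subseteq> {0..1}" by (intro image_subsetI convex_unit target_range) auto
    ultimately have "continuous_map (top_of_set ?S) ?I ?r"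
      by (auto simp: continuous_map_in_subtopology)
    from continuous_map_compose[OF this char_continuous[OF e]]
    show "continuous_map (top_of_set ?S) X (\<lambda>z. (\<lambda>(x, s). slide \<tau> s x) (char e (fst z), snd z))"
      by (rule continuous_map_eq) (use \<tau> e in \<open>auto simp: slide_char\<close>)
  next
    fix v assume v: "v \<in> verts G"
    then show "continuous_map (top_of_set {u \<in> {0..1}. (v, u) \<in> ?O \<times> {0..1}}) X (\<lambda>u. (\<lambda>(x, s). slide \<tau> s x) (v, u))"
      by (simp add: slide_def verts_topspace)
  qed
  moreover have "prod_topology (subtopology X {x. height x \<noteq> \<tau>}) ?I = subtopology (prod_topology X ?I) (?O \<times> {0..1})"
  proof -
    have "?O = topspace X \<inter> {x. height x \<noteq> \<tau>}" by auto
    then show ?thesis by (simp only: subtopology_Times subtopology_restrict subtopology_subtopology Int_absorb)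
  qed
  ultimately show ?thesis by simp
qed

definition generic_pairs :: "nat \<Rightarrow> real \<Rightarrow> ((nat \<Rightarrow> 'a) \<times> (nat \<Rightarrow> 'a)) set" where
  "generic_pairs n \<tau> = {z \<in> confs n \<times> confs n. \<forall>i<n. height (fst z i) \<noteq> \<tau> \<and> height (snd z i) \<noteq> \<tau>}"

lemma openin_generic_pairs:
  "openin (prod_topology (disc_conf n G) (disc_conf n G)) (generic_pairs n \<tau>)"
proof -
  let ?P = "prod_topology (disc_conf n G) (disc_conf n G)"
  have 1: "openin ?P {z \<in> topspace ?P. height (fst z i) \<in> - {\<tau>}}" if "i < n" for i
    by (rule openin_continuous_map_preimage[OF continuous_map_compose[OF continuous_map_compose[OF continuous_map_fst
        continuous_map_disc_conf_coord[OF that]] height_continuous, unfolded o_def]]) auto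
  have 2: "openin ?P {z \<in> topspace ?P. height (snd z i) \<in> - {\<tau>}}" if "i < n" for i
    by (rule openin_continuous_map_preimage[OF continuous_map_compose[OF continuous_map_compose[OF continuous_map_snd
        continuous_map_disc_conf_coord[OF that]] height_continuous, unfolded o_def]]) auto
  have "openin ?P (topspace ?P \<inter> (\<Inter>i<n. {z \<in> topspace ?P. height (fst z i) \<in> - {\<tau>}} \<inter> {z \<in> topspace ?P. height (snd z i) \<in> - {\<tau>}}))"
    using 1 2 by (intro openin_Int_Inter openin_Int openin_topspace) (auto simp del: topspace_prod_topology)
  also have "topspace ?P \<inter> (\<Inter>i<n. {z \<in> topspace ?P. height (fst z i) \<in> - {\<tau>}} \<inter> {z \<in> topspace ?P. height (snd z i) \<in> - {\<tau>}}) = generic_pairs n \<tau>"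
    by (auto simp: generic_pairs_def topspace_disc_conf)
  finally show ?thesis .
qed

text \<open>All coordinates slide at the same time. They end at vertices and midpoints of edges, and there are only
  finitely many configurations of such points.\<close>

lemma has_section_on_generic_pairs:
  assumes pc: "path_connected_space (disc_conf n G)" and \<tau>: "0 < \<tau>" "\<tau> < 1/2"
  shows "has_section_on (disc_conf n G) (generic_pairs n \<tau>)"
proof -
  let ?D = "disc_conf n G"
  let ?I = "top_of_set {0..1::real}"
  let ?Y = "subtopology (prod_topology ?D ?D) (generic_pairs n \<tau>)"
  define move where "move = (\<lambda>pr (z::(nat \<Rightarrow> 'a) \<times> (nat \<Rightarrow> 'a)) t. \<lambda>i\<in>{..<n}. slide \<tau> t (pr z i :: 'a))"
  define F where "F = ({..<n} \<rightarrow>\<^sub>E (verts G \<union> (\<lambda>e. char e (1/2)) ` edges G))"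
  have tY: "topspace ?Y = generic_pairs n \<tau>" by (auto simp: generic_pairs_def topspace_disc_conf)
  have pr: "pr z \<in> confs n \<and> (\<forall>i<n. height (pr z i) \<noteq> \<tau> \<and> pr z i \<in> topspace X)"
    if "z \<in> generic_pairs n \<tau>" "pr = fst \<or> pr = snd" for z pr
    using that confs_topspace by (auto simp: generic_pairs_def)
  have cont: "continuous_map (prod_topology ?Y ?I) ?D (\<lambda>(z, t). move pr z t)"
    if p: "pr = fst \<or> pr = snd" for pr
  proof (rule continuous_map_disc_conf)
    fix i assume i: "i < n"
    have "continuous_map (prod_topology ?D ?D) ?D pr"
      using p continuous_map_fst continuous_map_snd by blast
    from continuous_map_compose[OF continuous_map_from_subtopology[OF this] continuous_map_disc_conf_coord[OF i]]
    have "continuous_map ?Y X (\<lambda>z. pr z i)" by (simp add: o_def)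
    moreover have "(\<lambda>z. pr z i) ` topspace ?Y \<subseteq> {x. height x \<noteq> \<tau>}"
      using pr[OF _ p] i unfolding tY by blast
    ultimately have "continuous_map ?Y (subtopology X {x. height x \<noteq> \<tau>}) (\<lambda>z. pr z i)"
      by (auto simp: continuous_map_in_subtopology)
    then have "continuous_map (prod_topology ?Y ?I) (prod_topology (subtopology X {x. height x \<noteq> \<tau>}) ?I) (\<lambda>z. (pr (fst z) i, snd z))"
      by (intro continuous_map_pairedI continuous_map_snd continuous_map_compose[OF continuous_map_fst, unfolded o_def])
    from continuous_map_compose[OF this slide_continuous[OF \<tau>]]
    show "continuous_map (prod_topology ?Y ?I) X (\<lambda>y. (\<lambda>(z, t). move pr z t) y i)"
      by (rule continuous_map_eq) (simp add: i case_prod_unfold move_def)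
  next
    fix y i j assume y: "y \<in> topspace (prod_topology ?Y ?I)" and ij: "i < n" "j < n" "i \<noteq> j"
    have "y \<in> generic_pairs n \<tau> \<times> {0..1}" using y unfolding topspace_prod_topology tY by simp
    then have g: "fst y \<in> generic_pairs n \<tau>" "snd y \<in> {0..1}" by (simp_all add: mem_Times_iff)
    then have "pr (fst y) \<in> confs n" using pr p by blast
    then have "corners (pr (fst y) i) \<inter> corners (pr (fst y) j) = {}" "pr (fst y) i \<in> topspace X" "pr (fst y) j \<in> topspace X"
      using ij by (auto simp: confs_def)
    then show "corners ((\<lambda>(z, t). move pr z t) y i) \<inter> corners ((\<lambda>(z, t). move pr z t) y j) = {}"
      using slide_corners[of "pr (fst y) i" "snd y" \<tau>] slide_corners[of "pr (fst y) j" "snd y" \<tau>] ij g(2)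
      unfolding case_prod_unfold move_def by fastforce
  qed (auto simp: move_def case_prod_unfold)
  show ?thesis
  proof (rule has_section_on_deformable[OF pc])
    show "Hausdorff_space ?D"
      unfolding disc_conf_eq by (intro Hausdorff_space_subtopology) (simp add: Hausdorff_space_product_topology Hausdorff_X)
    show "finite F" unfolding F_def using finite_verts finite_edges by (intro finite_PiE) auto
    show "generic_pairs n \<tau> \<subseteq> topspace ?D \<times> topspace ?D" by (auto simp: generic_pairs_def topspace_disc_conf)
    show "continuous_map (prod_topology ?Y ?I) ?D (\<lambda>(z, t). move fst z t)"
      "continuous_map (prod_topology ?Y ?I) ?D (\<lambda>(z, t). move snd z t)" using cont by auto
  next
    fix z assume z: "z \<in> generic_pairs n \<tau>"
    have "move pr z 0 = pr z" if p: "pr = fst \<or> pr = snd" for pr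
    proof
      fix i have "pr z \<in> extensional {..<n}" using pr[OF z p] by (auto simp: confs_def PiE_iff)
      then show "move pr z 0 i = pr z i"
        using pr[OF z p] by (auto simp: move_def slide_0 extensional_def)
    qed
    then show "move fst z 0 = fst z \<and> move snd z 0 = snd z" by blast
    have "move pr z 1 \<in> F" if p: "pr = fst \<or> pr = snd" for pr
      using pr[OF z p] slide_1[OF _ \<tau>] unfolding F_def move_def by (intro restrict_PiE_iff[THEN iffD2] ballI) auto
    then show "move fst z 1 \<in> F \<and> move snd z 1 \<in> F" by blast
  qed
qed

text \<open>A pair of configurations has at most \<open>2 * n\<close> heights, so it avoids one of \<open>2 * n + 1\<close> thresholds.\<close>

theorem TC_disc_conf_le:
  assumes "path_connected_space (disc_conf n G)"
  shows "TC (disc_conf n G) \<le> enat (2 * n + 1)"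
  unfolding TC_def
proof (rule Inf_lower, intro CollectI exI conjI refl)
  let ?D = "disc_conf n G"
  define \<tau> where "\<tau> = (\<lambda>k::nat. 1 / real (k + 3))"
  have \<tau>: "0 < \<tau> k" "\<tau> k < 1/2" for k by (auto simp: \<tau>_def field_simps)
  show "\<forall>k<2 * n + 1. openin (prod_topology ?D ?D) (generic_pairs n (\<tau> k)) \<and> has_section_on ?D (generic_pairs n (\<tau> k))"
    using openin_generic_pairs has_section_on_generic_pairs[OF assms] \<tau> by blast
  show "(\<Union>k<2 * n + 1. generic_pairs n (\<tau> k)) = topspace (prod_topology ?D ?D)"
  proof
    show "(\<Union>k<2 * n + 1. generic_pairs n (\<tau> k)) \<subseteq> topspace (prod_topology ?D ?D)"
      by (auto simp: generic_pairs_def topspace_disc_conf)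
    show "topspace (prod_topology ?D ?D) \<subseteq> (\<Union>k<2 * n + 1. generic_pairs n (\<tau> k))"
    proof
      fix z assume z: "z \<in> topspace (prod_topology ?D ?D)"
      define A where "A = (\<lambda>i. height (fst z i)) ` {..<n} \<union> (\<lambda>i. height (snd z i)) ` {..<n}"
      have "card A \<le> n + n"
        unfolding A_def by (intro order_trans[OF card_Un_le] add_mono order_trans[OF card_image_le]) auto
      moreover have "inj_on \<tau> {..<2 * n + 1}" by (auto simp: inj_on_def \<tau>_def)
      then have "card (\<tau> ` {..<2 * n + 1}) = 2 * n + 1" by (simp add: card_image)
      moreover have "finite A" by (simp add: A_def)
      ultimately have "\<not> \<tau> ` {..<2 * n + 1} \<subseteq> A" using card_mono[of A "\<tau> ` {..<2 * n + 1}"] by linarith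
      then obtain k where "k < 2 * n + 1" "\<tau> k \<notin> A" by auto
      then have "height (fst z i) \<noteq> \<tau> k \<and> height (snd z i) \<noteq> \<tau> k" if "i < n" for i
        using that unfolding A_def by (metis UnI1 UnI2 imageI lessThan_iff)
      then have "z \<in> generic_pairs n (\<tau> k)"
        using z by (auto simp: generic_pairs_def topspace_disc_conf)
      then show "z \<in> (\<Union>k<2 * n + 1. generic_pairs n (\<tau> k))"
        using \<open>k < 2 * n + 1\<close> by blast
    qed
  qed
qed simp

end

section \<open>Moving labelled tokens on a graph\<close>

text \<open>This section is purely combinatorial: \<open>n\<close> labelled tokens sit on different vertices of a graph, given by its
  adjacency relation \<open>A\<close>, and a move takes one token to an adjacent free vertex.\<close>

definition placements :: "nat \<Rightarrow> 'a set \<Rightarrow> (nat \<Rightarrow> 'a) set" where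
  "placements n V = {f \<in> {..<n} \<rightarrow>\<^sub>E V. inj_on f {..<n}}"

definition pebble_move :: "nat \<Rightarrow> 'a set \<Rightarrow> ('a \<Rightarrow> 'a \<Rightarrow> bool) \<Rightarrow> (nat \<Rightarrow> 'a) \<Rightarrow> (nat \<Rightarrow> 'a) \<Rightarrow> bool" where
  "pebble_move n V A f g \<longleftrightarrow> f \<in> placements n V \<and>
     (\<exists>i<n. \<exists>w\<in>V. A (f i) w \<and> w \<notin> f ` {..<n} \<and> g = f(i := w))"

locale pebble_graph =
  fixes n :: nat and V :: "'a set" and A :: "'a \<Rightarrow> 'a \<Rightarrow> bool"
  assumes A_sym: "A u v \<Longrightarrow> A v u"
    and A_V: "A u v \<Longrightarrow> u \<in> V \<and> v \<in> V"
begin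

abbreviation reach where "reach \<equiv> (pebble_move n V A)\<^sup>*\<^sup>*"

lemma pebble_moveI:
  assumes "f \<in> placements n V" "i < n" "A (f i) w" "w \<notin> f ` {..<n}"
  shows "pebble_move n V A f (f(i := w))"
  using assms A_V unfolding pebble_move_def by blast

lemma placements_update:
  assumes "f \<in> placements n V" "i < n" "w \<in> V" "w \<notin> f ` {..<n}"
  shows "f(i := w) \<in> placements n V"
  using assms unfolding placements_def PiE_iff extensional_def inj_on_def by auto

lemma pebble_move_placements: "pebble_move n V A f g \<Longrightarrow> f \<in> placements n V \<and> g \<in> placements n V"
  unfolding pebble_move_def using placements_update by blast

lemma reach_placements: "reach f g \<Longrightarrow> f \<in> placements n V \<Longrightarrow> g \<in> placements n V"
  by (induction rule: rtranclp_induct) (auto dest: pebble_move_placements)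

lemma pebble_move_sym: assumes "pebble_move n V A f g" shows "pebble_move n V A g f"
proof -
  obtain i w where f: "f \<in> placements n V" and i: "i < n" "w \<in> V" "A (f i) w" "w \<notin> f ` {..<n}"
    and g: "g = f(i := w)"
    using assms unfolding pebble_move_def by blast
  have inj: "inj_on f {..<n}" using f by (simp add: placements_def)
  have "f i \<notin> g ` {..<n}"
    using i g inj by (auto simp: inj_on_def split: if_splits)
  then have "pebble_move n V A g (g(i := f i))"
    using i g A_sym pebble_move_placements[OF assms] by (intro pebble_moveI) auto
  then show ?thesis using g by simp
qed

lemma reach_sym: "reach f g \<Longrightarrow> reach g f"
  by (induction rule: rtranclp_induct) (auto intro: converse_rtranclp_into_rtranclp pebble_move_sym)

text \<open>The rules do not depend on the labels. Hence the permutations that can be realised from a fixed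
  placement are closed under composition.\<close>

lemma pebble_move_relabel:
  assumes "pebble_move n V A f g" "p permutes {..<n}"
  shows "pebble_move n V A (f \<circ> p) (g \<circ> p)"
proof -
  obtain i w where f: "f \<in> placements n V" and i: "i < n" "w \<in> V" "A (f i) w" "w \<notin> f ` {..<n}"
    and g: "g = f(i := w)"
    using assms unfolding pebble_move_def by blast
  have pn: "p j < n \<longleftrightarrow> j < n" for j using permutes_in_image[OF assms(2), of j] by simp
  have "f \<circ> p \<in> placements n V"
    using f pn permutes_not_in[OF assms(2)] comp_inj_on[of p "{..<n}" f]
      permutes_image[OF assms(2)] permutes_inj_on[OF assms(2)]
    by (force simp: placements_def PiE_iff extensional_def)
  moreover have "inv p i < n" "p (inv p i) = i"
    using i permutes_in_image[OF permutes_inv[OF assms(2)], of i] permutes_inverses[OF assms(2)] by auto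
  moreover have "(f \<circ> p) ` {..<n} = f ` {..<n}"
    using permutes_image[OF assms(2)] by (metis image_comp)
  ultimately have "pebble_move n V A (f \<circ> p) ((f \<circ> p)(inv p i := w))"
    using i by (intro pebble_moveI) auto
  moreover have "(f \<circ> p)(inv p i := w) = g \<circ> p"
    using permutes_inverses[OF assms(2)] by (auto simp: g fun_eq_iff)
  ultimately show ?thesis by simp
qed

lemma reach_relabel: "reach f g \<Longrightarrow> p permutes {..<n} \<Longrightarrow> reach (f \<circ> p) (g \<circ> p)"
  by (induction rule: rtranclp_induct) (auto intro: rtranclp.rtrancl_into_rtrancl pebble_move_relabel)

text \<open>For unlabelled tokens, a token can be moved from \<open>s\<close> to a free vertex \<open>t\<close> along any path: if a token
  blocks the way, it goes to \<open>t\<close> first, and the other one takes its place.\<close>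

lemma shift_along_path:
  assumes "A\<^sup>*\<^sup>* s t" "f \<in> placements n V" "s \<in> f ` {..<n}" "t \<notin> f ` {..<n}"
  shows "\<exists>g. reach f g \<and> g ` {..<n} = insert t (f ` {..<n} - {s})"
  using assms
proof (induction arbitrary: f rule: converse_rtranclp_induct)
  case base
  then show ?case by simp
next
  case (step s s')
  have move: "\<exists>h. reach g h \<and> h ` {..<n} = insert s' (g ` {..<n} - {s})"
    if g: "g \<in> placements n V" "s \<in> g ` {..<n}" "s' \<notin> g ` {..<n}" for g
  proof -
    obtain i where i: "i < n" "s = g i" using g(2) by blast
    have "pebble_move n V A g (g(i := s'))"
      using g i step by (intro pebble_moveI) auto
    moreover have "(g(i := s')) ` {..<n} = insert s' (g ` {..<n} - {s})"
      using g i by (auto simp: placements_def inj_on_def fun_upd_image)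
    ultimately show ?thesis by blast
  qed
  show ?case
  proof (cases "s' \<in> f ` {..<n}")
    case False
    obtain h where h: "reach f h" "h ` {..<n} = insert s' (f ` {..<n} - {s})"
      using move[of f] step False by blast
    show ?thesis
    proof (cases "s' = t")
      case True then show ?thesis using h by auto
    next
      case ne: False
      then obtain g where g: "reach h g" "g ` {..<n} = insert t (h ` {..<n} - {s'})"
        using step.IH[of h] h step.prems reach_placements by auto
      have "insert t (h ` {..<n} - {s'}) = insert t (f ` {..<n} - {s})"
        using h False by auto
      then show ?thesis using rtranclp_trans[OF h(1) g(1)] g(2) by auto
    qed
  next
    case True
    obtain h where h: "reach f h" "h ` {..<n} = insert t (f ` {..<n} - {s'})"
      using step.IH[of f] True step.prems by blast
    show ?thesis
    proof (cases "s = s'")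
      case True then show ?thesis using h by auto
    next
      case ne: False
      then obtain g where g: "reach h g" "g ` {..<n} = insert s' (h ` {..<n} - {s})"
        using move[of h] h step.prems reach_placements True by auto
      have "insert s' (h ` {..<n} - {s}) = insert t (f ` {..<n} - {s})"
        using h True ne step.prems by auto
      then show ?thesis using rtranclp_trans[OF h(1) g(1)] g(2) by auto
    qed
  qed
qed

text \<open>Shifting one token after the other makes the occupied set any prescribed set of \<open>n\<close> vertices.\<close>

lemma reach_occupying:
  assumes conn: "\<And>u v. u \<in> V \<Longrightarrow> v \<in> V \<Longrightarrow> A\<^sup>*\<^sup>* u v"
    and "f \<in> placements n V" "S \<subseteq> V" "finite S" "card S = n"
  shows "\<exists>g. reach f g \<and> g ` {..<n} = S"
  using assms(2)
proof (induction "card (S - f ` {..<n})" arbitrary: f)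
  case 0
  then have "S \<subseteq> f ` {..<n}" using assms(4) by simp
  moreover have "card (f ` {..<n}) = n" using 0 by (simp add: placements_def card_image)
  ultimately have "f ` {..<n} = S" using assms(5) by (metis card_subset_eq finite_imageI finite_lessThan)
  then show ?case by blast
next
  case (Suc k)
  have card: "card (f ` {..<n}) = n" using Suc by (simp add: placements_def card_image)
  obtain t where t: "t \<in> S" "t \<notin> f ` {..<n}" using Suc by (metis Diff_iff card_0_eq card.empty ex_in_conv nat.distinct(1))
  have "\<not> f ` {..<n} \<subseteq> S"
    using card_subset_eq[OF assms(4)] card assms(5) t by metis
  then obtain s where s: "s \<in> f ` {..<n}" "s \<notin> S" by blast
  have "A\<^sup>*\<^sup>* s t" using s t conn assms(3) Suc.prems by (auto simp: placements_def PiE_iff)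
  then obtain g where g: "reach f g" "g ` {..<n} = insert t (f ` {..<n} - {s})"
    using shift_along_path s t Suc.prems by blast
  have "S - g ` {..<n} = (S - f ` {..<n}) - {t}" using g s t by auto
  then have "k = card (S - g ` {..<n})" using Suc.hyps(2) t assms(4) by simp
  then obtain h where h: "reach g h" "h ` {..<n} = S"
    using Suc.hyps(1)[of g] g reach_placements Suc.prems by blast
  then have "reach f h" using rtranclp_trans[OF g(1) h(1)] by simp
  then show ?case using h by blast
qed

end

lemma mod_shift_eq:
  fixes a b L :: nat
  assumes "a \<le> b" "b < a + L" "a mod L = b mod L" shows "a = b"
proof -
  have "L dvd b - a" using assms(1) assms(3)[symmetric] by (simp add: mod_eq_dvd_iff_nat)
  moreover have "b - a < L" using assms by linarith
  ultimately have "b - a = 0" using nat_dvd_not_less[of "b - a" L] by auto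
  then show ?thesis using assms by linarith
qed

lemma mod_shift_eq_iff:
  fixes a b k L :: nat
  assumes "k \<le> a" "k \<le> b" "a < k + L" "b < k + L" shows "a mod L = b mod L \<longleftrightarrow> a = b"
proof
  assume "a mod L = b mod L"
  then show "a = b" using mod_shift_eq[of a b L] mod_shift_eq[of b a L] assms by linarith
qed simp

text \<open>A cycle with more vertices than tokens, and a vertex \<open>y\<close> off the cycle, called the exit,
  adjacent to \<open>z 0\<close>.\<close>

locale pebble_cycle = pebble_graph +
  fixes L :: nat and z :: "nat \<Rightarrow> 'a" and y :: 'a
  assumes L: "n < L" "3 \<le> L"
    and z_inj: "inj_on z {..<L}"
    and z_adj: "i < L \<Longrightarrow> A (z i) (z (Suc i mod L))"
    and exit: "A (z 0) y" "y \<notin> z ` {..<L}"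
begin

text \<open>The tokens form a block of consecutive vertices that starts at \<open>k\<close>, with one gap: the tokens from
  \<open>m\<close> on are one vertex ahead. As \<open>m\<close> decreases from \<open>n\<close> to \<open>0\<close>, the gap moves through the block, and
  the block that started at \<open>k\<close> becomes the one that starts at \<open>Suc k\<close>.\<close>

definition rotated :: "nat \<Rightarrow> nat \<Rightarrow> nat \<Rightarrow> 'a" where
  "rotated k m = (\<lambda>j\<in>{..<n}. z ((j + k + (if j < m then 0 else 1)) mod L))"

lemma z_V: "z (i mod L) \<in> V"
  using z_adj[of "i mod L"] A_V L by auto

lemma z_eq: "z (i mod L) = z (j mod L) \<longleftrightarrow> i mod L = j mod L"
  using z_inj L by (auto simp: inj_on_def)

lemma rotated_placements: "rotated k m \<in> placements n V"
proof -
  have "inj_on (rotated k m) {..<n}"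
  proof (rule inj_onI)
    fix i j assume ij: "i \<in> {..<n}" "j \<in> {..<n}" "rotated k m i = rotated k m j"
    then have "(i + k + (if i < m then 0 else 1)) mod L = (j + k + (if j < m then 0 else 1)) mod L"
      by (simp add: rotated_def z_eq)
    then have "i + k + (if i < m then 0 else 1) = j + k + (if j < m then 0 else 1)"
      using ij L by (subst (asm) mod_shift_eq_iff[of k]) auto
    then show "i = j" by (auto split: if_splits)
  qed
  then show ?thesis using z_V by (auto simp: placements_def rotated_def)
qed

lemma rotated_notin: "m \<le> n \<Longrightarrow> z ((m + k) mod L) \<notin> rotated k m ` {..<n}"
proof
  assume m: "m \<le> n" and "z ((m + k) mod L) \<in> rotated k m ` {..<n}"
  then obtain j where j: "j < n" "(m + k) mod L = (j + k + (if j < m then 0 else 1)) mod L"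
    by (auto simp: rotated_def z_eq)
  then have "m + k = j + k + (if j < m then 0 else 1)"
    using m L by (subst (asm) mod_shift_eq_iff[of k]) auto
  then show False by (auto split: if_splits)
qed

lemma rotated_step:
  assumes "m < n" shows "reach (rotated k (Suc m)) (rotated k m)"
proof -
  have "pebble_move n V A (rotated k (Suc m)) ((rotated k (Suc m))(m := z ((Suc m + k) mod L)))"
  proof (rule pebble_moveI)
    show "A (rotated k (Suc m) m) (z ((Suc m + k) mod L))"
      using z_adj[of "(m + k) mod L"] assms L by (simp add: rotated_def mod_Suc_eq)
    show "z ((Suc m + k) mod L) \<notin> rotated k (Suc m) ` {..<n}" using assms by (intro rotated_notin) auto
  qed (use assms rotated_placements in auto)
  moreover have "(rotated k (Suc m))(m := z ((Suc m + k) mod L)) = rotated k m"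
    using assms by (auto simp: rotated_def fun_eq_iff less_Suc_eq)
  ultimately show ?thesis by simp
qed

lemma reach_rotated_same: "m \<le> n \<Longrightarrow> reach (rotated k n) (rotated k m)"
proof (induction "n - m" arbitrary: m)
  case 0 then show ?case by simp
next
  case (Suc d)
  then have "reach (rotated k n) (rotated k (Suc m))" by (intro Suc) auto
  moreover have "reach (rotated k (Suc m)) (rotated k m)" using Suc by (intro rotated_step) auto
  ultimately show ?case by (meson rtranclp_trans)
qed

lemma reach_rotated: "m \<le> n \<Longrightarrow> reach (rotated 0 n) (rotated k m)"
proof -
  have step: "rotated (Suc k) n = rotated k 0" for k by (auto simp: rotated_def fun_eq_iff)
  have "reach (rotated 0 n) (rotated k n)" for k
  proof (induction k)
    case (Suc k)
    show ?case using rtranclp_trans[OF Suc reach_rotated_same[of 0 k]] step by simp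
  qed simp
  then show "m \<le> n \<Longrightarrow> ?thesis" using rtranclp_trans[OF _ reach_rotated_same[of m k]] by simp
qed

text \<open>The tokens \<open>i\<close> and \<open>j\<close> sit on the two neighbours of \<open>z 0\<close> on the cycle. Token \<open>i\<close> waits at \<open>y\<close> while
  token \<open>j\<close> passes through \<open>z 0\<close> to its new place; then token \<open>i\<close> takes the place of \<open>j\<close>.\<close>

lemma swap_at_exit:
  assumes f: "f \<in> placements n V" and ij: "i < n" "j < n" "i \<noteq> j"
    and fi: "f i = z (L - 1)" and fj: "f j = z 1"
    and free: "z 0 \<notin> f ` {..<n}" "y \<notin> f ` {..<n}"
  shows "reach f (f \<circ> Transposition.transpose i j)"
proof -
  let ?a = "z (L - 1)" and ?b = "z 1" and ?w = "z 0"
  have dist: "?a \<noteq> ?b" "?a \<noteq> ?w" "?b \<noteq> ?w" "y \<noteq> ?a" "y \<noteq> ?b" "y \<noteq> ?w"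
    using inj_onD[OF z_inj, of "L - 1" 1] inj_onD[OF z_inj, of "L - 1" 0] inj_onD[OF z_inj, of 1 0]
      L exit(2) by auto
  have adj: "A ?a ?w" "A ?w ?b" "A ?w y"
    using z_adj[of "L - 1"] z_adj[of 0] L exit by (auto simp: mod_if)
  have adj': "A ?w ?a" "A ?b ?w" "A y ?w" using adj A_sym by blast+
  \<comment> \<open>The whole exchange takes place on these four vertices, where no other token sits.\<close>
  define Q where "Q = {?a, ?b, ?w, y}"
  have QV: "Q \<subseteq> V" using adj A_V by (auto simp: Q_def)
  have others: "f l \<notin> Q" if "l < n" "l \<noteq> i" "l \<noteq> j" for l
  proof -
    have "f l \<in> f ` {..<n}" using that by simp
    moreover have "f l \<noteq> f i" "f l \<noteq> f j"
      using f that ij by (auto simp: placements_def inj_on_def)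
    ultimately show ?thesis using fi fj free unfolding Q_def by (metis empty_iff insert_iff)
  qed
  define F where "F = (\<lambda>u v. f(i := u, j := v))"
  have F: "F u v i = u" "F u v j = v" "l \<noteq> i \<Longrightarrow> l \<noteq> j \<Longrightarrow> F u v l = f l" for u v l
    using ij by (auto simp: F_def)
  have Fpl: "F u v \<in> placements n V" if uv: "u \<in> Q" "v \<in> Q" "u \<noteq> v" for u v
  proof -
    have "inj_on (F u v) {..<n}"
    proof (rule inj_onI)
      fix k l assume kl: "k \<in> {..<n}" "l \<in> {..<n}" "F u v k = F u v l"
      have "F u v k = F u v l \<longrightarrow> k = l" if "k \<noteq> i" "k \<noteq> j" "l \<noteq> i" "l \<noteq> j"
        using that kl f by (simp add: F placements_def inj_on_def)
      then show "k = l"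
        using kl uv others[of k] others[of l] by (metis F lessThan_iff)
    qed
    then show ?thesis using f ij uv QV by (auto simp: placements_def F_def PiE_iff extensional_def)
  qed
  have Fimg: "w \<notin> F u v ` {..<n}" if "w \<in> Q" "w \<noteq> u" "w \<noteq> v" for u v w
  proof
    assume "w \<in> F u v ` {..<n}"
    then obtain l where l: "l < n" "w = F u v l" by auto
    then show False using others[of l] F \<open>w \<in> Q\<close> \<open>w \<noteq> u\<close> \<open>w \<noteq> v\<close> by (cases "l = i"; cases "l = j") auto
  qed
  have mi: "pebble_move n V A (F u v) (F u' v)"
    if "A u u'" "u \<in> Q" "u' \<in> Q" "v \<in> Q" "u \<noteq> v" "u' \<noteq> v" "u' \<noteq> u" for u u' v
  proof -
    have "pebble_move n V A (F u v) ((F u v)(i := u'))"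
      using that ij by (intro pebble_moveI Fpl Fimg) (auto simp: F)
    moreover have "(F u v)(i := u') = F u' v" using ij by (simp add: F_def fun_upd_twist)
    ultimately show ?thesis by simp
  qed
  have mj: "pebble_move n V A (F u v) (F u v')"
    if "A v v'" "u \<in> Q" "v' \<in> Q" "v \<in> Q" "u \<noteq> v" "u \<noteq> v'" "v' \<noteq> v" for u v v'
  proof -
    have "pebble_move n V A (F u v) ((F u v)(j := v'))"
      using that ij by (intro pebble_moveI Fpl Fimg) (auto simp: F)
    moreover have "(F u v)(j := v') = F u v'" using ij by (simp add: F_def)
    ultimately show ?thesis by simp
  qed
  have Q: "?a \<in> Q" "?b \<in> Q" "?w \<in> Q" "y \<in> Q" by (auto simp: Q_def)
  have "reach (F ?a ?b) (F ?w ?b)" using dist adj adj' Q by (simp add: mi r_into_rtranclp)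
  also have "reach (F ?w ?b) (F y ?b)" using dist adj adj' Q by (simp add: mi r_into_rtranclp)
  also have "reach (F y ?b) (F y ?w)" using dist adj adj' Q by (simp add: mj r_into_rtranclp)
  also have "reach (F y ?w) (F y ?a)" using dist adj adj' Q by (simp add: mj r_into_rtranclp)
  also have "reach (F y ?a) (F ?w ?a)" using dist adj adj' Q by (simp add: mi r_into_rtranclp)
  also have "reach (F ?w ?a) (F ?b ?a)" using dist adj adj' Q by (simp add: mi r_into_rtranclp)
  finally have "reach (F ?a ?b) (F ?b ?a)" .
  moreover have "F ?a ?b = f" using fi fj by (auto simp: F_def)
  moreover have "F ?b ?a = f \<circ> Transposition.transpose i j"
    using fi fj ij unfolding F_def fun_eq_iff Transposition.transpose_def by simp
  ultimately show ?thesis by simp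
qed

abbreviation "home \<equiv> rotated 0 n"

text \<open>Rotate until the gap between token \<open>i\<close> and its successor is at \<open>z 0\<close>, exchange the two tokens there,
  and rotate back.\<close>

lemma reach_home_adjacent:
  assumes "Suc i < n"
  shows "reach home (home \<circ> Transposition.transpose i (Suc i))"
proof -
  define h where "h = rotated (L - Suc i) (Suc i)"
  have tr: "Transposition.transpose i (Suc i) permutes {..<n}"
    using assms by (intro permutes_swap_id) auto
  have hh: "reach home h" unfolding h_def using assms by (intro reach_rotated) auto
  have free: "z 0 \<notin> h ` {..<n}"
    using rotated_notin[of "Suc i" "L - Suc i"] assms L by (simp add: h_def)
  have "h i = z (L - 1)" using assms L by (simp add: h_def rotated_def)
  moreover have "h (Suc i) = z 1"
  proof -
    have "(Suc i + (L - Suc i) + 1) mod L = 1" using assms L by (simp add: mod_if)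
    then show ?thesis using assms by (simp add: h_def rotated_def)
  qed
  moreover have "h ` {..<n} \<subseteq> z ` {..<L}"
    using L by (auto simp: h_def rotated_def)
  then have "y \<notin> h ` {..<n}" using exit by auto
  ultimately have "reach h (h \<circ> Transposition.transpose i (Suc i))"
    using free assms by (intro swap_at_exit) (auto simp: h_def rotated_placements)
  moreover have "reach (h \<circ> Transposition.transpose i (Suc i)) (home \<circ> Transposition.transpose i (Suc i))"
    by (rule reach_relabel[OF reach_sym[OF hh] tr])
  ultimately show ?thesis by (rule rtranclp_trans[OF rtranclp_trans[OF hh]])
qed

lemma reach_home_compose:
  assumes "reach home (home \<circ> p)" "reach home (home \<circ> q)" "q permutes {..<n}"
  shows "reach home (home \<circ> (p \<circ> q))"
  using rtranclp_trans[OF assms(2) reach_relabel[OF assms(1,3)]] by (simp add: comp_assoc)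

text \<open>Transpositions of neighbours generate all transpositions.\<close>

lemma reach_home_transpose:
  assumes "i < j" "j < n"
  shows "reach home (home \<circ> Transposition.transpose i j)"
  using assms
proof (induction j)
  case (Suc j)
  show ?case
  proof (cases "i = j")
    case True then show ?thesis using reach_home_adjacent Suc by blast
  next
    case False
    let ?s = "Transposition.transpose j (Suc j)" and ?t = "Transposition.transpose i j"
    have s: "reach home (home \<circ> ?s)" "?s permutes {..<n}"
      using reach_home_adjacent Suc by (auto intro!: permutes_swap_id)
    have t: "reach home (home \<circ> ?t)" using Suc.IH Suc.prems False by linarith
    have t': "?t permutes {..<n}" using Suc.prems by (intro permutes_swap_id) auto
    have "?s \<circ> (?t \<circ> ?s) = Transposition.transpose i (Suc j)"
      using False Suc by (auto simp: fun_eq_iff Transposition.transpose_def)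
    moreover have "reach home (home \<circ> (?s \<circ> (?t \<circ> ?s)))"
      by (rule reach_home_compose[OF s(1) reach_home_compose[OF t s] permutes_compose[OF s(2) t']])
    ultimately show ?thesis by metis
  qed
qed simp

lemma reach_home_permutes:
  assumes "p permutes {..<n}" shows "reach home (home \<circ> p)"
  using assms finite_lessThan
proof (induction rule: permutes_induct)
  case id then show ?case by simp
next
  case (swap a b p)
  have "reach home (home \<circ> Transposition.transpose a b)"
    using swap reach_home_transpose[of a b] reach_home_transpose[of b a]
    by (cases "a < b") (auto simp: transpose_commute)
  then show ?case using swap reach_home_compose by metis
qed

text \<open>Every placement reaches one that occupies the same vertices as \<open>home\<close>, hence differs from \<open>home\<close> by a
  permutation of the labels.\<close>

theorem placements_reachable:
  assumes conn: "\<And>u v. u \<in> V \<Longrightarrow> v \<in> V \<Longrightarrow> A\<^sup>*\<^sup>* u v"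
    and f: "f \<in> placements n V" and g: "g \<in> placements n V"
  shows "reach f g"
proof -
  have "reach home f" if f: "f \<in> placements n V" for f
  proof -
    have home: "home \<in> placements n V" by (rule rotated_placements)
    have "home ` {..<n} \<subseteq> V" "finite (home ` {..<n})" "card (home ` {..<n}) = n"
      using home by (auto simp: placements_def card_image)
    then obtain f' where f': "reach f f'" "f' ` {..<n} = home ` {..<n}"
      using reach_occupying[OF conn f] by blast
    have pl: "f' \<in> placements n V" using f f' reach_placements by blast
    define p where "p = (\<lambda>i. if i < n then inv_into {..<n} home (f' i) else i)"
    have hp: "home (p i) = f' i" "p i < n" if "i < n" for i
    proof -
      have im: "f' i \<in> home ` {..<n}" using that f' by blast
      show "home (p i) = f' i" using f_inv_into_f[OF im] that by (simp add: p_def)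
      show "p i < n" using inv_into_into[OF im] that by (simp add: p_def)
    qed
    have "inj_on p {..<n}"
    proof (rule inj_onI)
      fix i j assume ij: "i \<in> {..<n}" "j \<in> {..<n}" "p i = p j"
      then have "f' i = f' j" using hp(1)[of i] hp(1)[of j] by simp
      then show "i = j" using pl ij by (simp add: placements_def inj_on_def)
    qed
    moreover have "p ` {..<n} \<subseteq> {..<n}" using hp by auto
    ultimately have "bij_betw p {..<n} {..<n}" by (simp add: bij_betw_def endo_inj_surj)
    then have "p permutes {..<n}" by (intro bij_imp_permutes) (auto simp: p_def)
    then have "reach home (home \<circ> p)" by (rule reach_home_permutes)
    moreover have "home \<circ> p = f'"
    proof
      fix i show "(home \<circ> p) i = f' i"
      proof (cases "i < n")
        case False
        then have "f' i = undefined" using pl by (auto simp: placements_def PiE_iff extensional_def)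
        then show ?thesis using False by (simp add: p_def rotated_def)
      qed (use hp in simp)
    qed
    ultimately have "reach home f'" by simp
    then show "reach home f" by (rule rtranclp_trans[OF _ reach_sym[OF f'(1)]])
  qed
  then show ?thesis using rtranclp_trans[OF reach_sym[of home f], of g] f g by simp
qed

end

section \<open>Cycles\<close>

text \<open>The intervals between consecutive integers are a locally finite closed cover of the line.\<close>

lemma continuous_map_piecewise_unit:
  fixes F :: "int \<Rightarrow> real \<Rightarrow> 'b"
  assumes F: "\<And>k. continuous_map (top_of_set {0..1}) Y (F k)" and glue: "\<And>k. F k 1 = F (k + 1) 0"
  shows "continuous_map euclideanreal Y (\<lambda>t. F \<lfloor>t\<rfloor> (frac t))"
proof (rule pasting_lemma_locally_finite[where I = UNIV and T = "\<lambda>k. {of_int k..of_int k + 1}" and f = "\<lambda>k t. F k (t - of_int k)"])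
  fix x :: real
  have "{k \<in> UNIV. {real_of_int k..of_int k + 1} \<inter> ball x 1 \<noteq> {}} \<subseteq> {\<lfloor>x\<rfloor> - 2..\<lfloor>x\<rfloor> + 2}"
  proof
    fix k assume "k \<in> {k \<in> UNIV. {real_of_int k..of_int k + 1} \<inter> ball x 1 \<noteq> {}}"
    then obtain t where "real_of_int k \<le> t" "t \<le> real_of_int k + 1" "\<bar>x - t\<bar> < 1" by (auto simp: dist_real_def)
    then show "k \<in> {\<lfloor>x\<rfloor> - 2..\<lfloor>x\<rfloor> + 2}" by (auto simp: le_floor_iff floor_le_iff) linarith+
  qed
  then show "\<exists>V. openin euclideanreal V \<and> x \<in> V \<and> finite {k \<in> UNIV. {real_of_int k..of_int k + 1} \<inter> V \<noteq> {}}"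
    using finite_subset by (intro exI[of _ "ball x 1"]) auto
next
  fix k :: int
  have "continuous_map (top_of_set {real_of_int k..of_int k + 1}) (top_of_set {0..1}) (\<lambda>t. t - of_int k)"
    by (auto simp: continuous_map_in_subtopology intro!: continuous_intros)
  from continuous_map_compose[OF this F[of k]]
  show "continuous_map (subtopology euclideanreal {real_of_int k..of_int k + 1}) Y (\<lambda>t. F k (t - of_int k))"
    by (simp add: o_def)
next
  fix i j :: int and x :: real
  assume x: "x \<in> topspace euclideanreal \<inter> {real_of_int i..of_int i + 1} \<inter> {real_of_int j..of_int j + 1}"
  have aux: "F i (x - of_int i) = F j (x - of_int j)"
    if "i < j" "real_of_int j \<le> x" "x \<le> real_of_int i + 1" for i j
  proof -
    have "real_of_int j \<le> real_of_int (i + 1)" using that by simp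
    then have j: "j = i + 1" using that(1) unfolding of_int_le_iff by simp
    then have "x = real_of_int i + 1" using that by simp
    then show ?thesis using glue[of i] j by simp
  qed
  show "F i (x - of_int i) = F j (x - of_int j)"
  proof (cases i j rule: linorder_cases)
    case less then show ?thesis using x by (intro aux) auto
  next
    case equal then show ?thesis by simp
  next
    case greater then show ?thesis using x by (intro aux[symmetric]) auto
  qed
next
  fix x :: real
  show "\<exists>j. j \<in> UNIV \<and> x \<in> {real_of_int j..of_int j + 1} \<and> F \<lfloor>x\<rfloor> (frac x) = F j (x - of_int j)"
    by (intro exI[of _ "\<lfloor>x\<rfloor>"]) (auto simp: frac_def)
qed auto

text \<open>The interval is simply connected, the circle is not.\<close>

lemma unit_interval_not_circle:
  "\<not> top_of_set {0..1::real} homeomorphic_space top_of_set (sphere (0::complex) 1)"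
proof
  assume "top_of_set {0..1::real} homeomorphic_space top_of_set (sphere (0::complex) 1)"
  then obtain f g where "homeomorphic_maps (top_of_set {0..1::real}) (top_of_set (sphere (0::complex) 1)) f g"
    unfolding homeomorphic_space_def by blast
  then have "homeomorphism {0..1::real} (sphere (0::complex) 1) f g"
  proof -
    assume fg: "homeomorphic_maps (top_of_set {0..1}) (top_of_set (sphere 0 1)) f g"
    then have c: "continuous_on {0..1} f" "f ` {0..1} \<subseteq> sphere 0 1"
        "continuous_on (sphere 0 1) g" "g ` sphere 0 1 \<subseteq> {0..1}"
      by (auto simp: homeomorphic_maps_def continuous_map_in_subtopology)
    have "\<forall>x\<in>{0..1}. g (f x) = x" "\<forall>y\<in>sphere 0 1. f (g y) = y"
      using fg by (simp_all add: homeomorphic_maps_def)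
    then show ?thesis using c by (intro homeomorphismI) auto
  qed
  then have "{0..1::real} homeomorphic sphere (0::complex) 1"
    by (auto simp: homeomorphic_def)
  moreover have "simply_connected {0..1::real}" by (intro convex_imp_simply_connected) auto
  ultimately have "simply_connected (sphere (0::complex) 1)"
    using homeomorphic_simply_connected by blast
  then show False by (simp add: simply_connected_sphere_eq)
qed

locale graph_cycle = graph_space G for G :: "('a, 'e) graph" +
  fixes vs :: "'a list" and es :: "'e list"
  assumes cycle: "is_cycle G (vs, es)"
begin

abbreviation "L \<equiv> length vs"

lemma L_pos: "L > 0" and distinct_vs: "distinct vs" and vs_verts: "set vs \<subseteq> verts G"
  and length_es: "length es = L" and es_edges: "set es \<subseteq> edges G"
  and cycle_joins: "i < L \<Longrightarrow> joins G (es ! i) (vs ! i) (vs ! (Suc i mod L))"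
  and cycle_circle: "subtopology X (\<Union>e\<in>set es. closed_edge G e) homeomorphic_space top_of_set (sphere (0::complex) 1)"
  using cycle by (auto simp: is_cycle_def)

lemma es_edge: "i < L \<Longrightarrow> es ! i \<in> edges G"
  using es_edges length_es by (metis nth_mem subsetD)

lemma es_ends: "i < L \<Longrightarrow> {char (es ! i) 0, char (es ! i) 1} = {vs ! i, vs ! (Suc i mod L)}"
  using cycle_joins by (simp add: joins_def)

text \<open>The first edge of a cycle is not traversed again. On three or more vertices this follows from
  the distinctness of the vertices. On two vertices the edges could coincide; then the cycle would be an arc
  instead of a circle.\<close>

lemma first_edge_once:
  assumes i: "0 < i" "i < L" shows "es ! i \<noteq> es ! 0"
proof
  assume eq: "es ! i = es ! 0"
  have ends: "{vs ! 0, vs ! (1 mod L)} = {vs ! i, vs ! (Suc i mod L)}"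
    using es_ends[OF i(2)] es_ends[of 0] eq L_pos by simp
  have nth: "vs ! a = vs ! b \<longleftrightarrow> a = b" if "a < L" "b < L" for a b
    using that distinct_vs nth_eq_iff_index_eq by blast
  have L2: "L \<ge> 2" using i by simp
  then have 1: "1 mod L = 1" by simp
  have less: "Suc i mod L < L" "0 < L" "1 < L" using L2 mod_less_divisor[of L "Suc i"] by linarith+
  have "vs ! 0 = vs ! i \<or> vs ! 0 = vs ! (Suc i mod L) \<and> vs ! 1 = vs ! i"
    using ends unfolding 1 doubleton_eq_iff by blast
  then have i1: "i = 1" and j0: "0 = Suc i mod L"
    using nth[OF less(2) i(2)] nth[OF less(2,1)] nth[OF less(3) i(2)] i(1) by auto
  have "L = 2"
  proof (rule ccontr)
    assume "L \<noteq> 2"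
    then have "Suc i mod L = 2" using i1 L2 by simp
    then show False using j0 by simp
  qed
  then have "es = [es ! 0, es ! 1]" using length_es by (simp add: list_eq_iff_nth_eq less_2_cases_iff nth_Cons')
  then have "set es = {es ! 0}" using eq i1 by (metis insert_absorb2 empty_set list.simps(15))
  then have circ: "subtopology X (closed_edge G (es ! 0)) homeomorphic_space top_of_set (sphere (0::complex) 1)"
    using cycle_circle by simp
  let ?e = "es ! 0"
  have e: "?e \<in> edges G" using es_edge[of 0] L_pos by simp
  have ne: "char ?e 0 \<noteq> char ?e 1"
    using es_ends[of 0] nth[of 0 1] L2 1 L_pos by (auto simp: doubleton_eq_iff)
  have "inj_on (char ?e) {0..1}"
  proof (rule inj_onI)
    fix s t :: real assume st: "s \<in> {0..1}" "t \<in> {0..1}" "char ?e s = char ?e t"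
    have mid: "char ?e u \<notin> {char ?e 0, char ?e 1}" if "0 < u" "u < 1" for u
      using char_notin_verts[OF e that] char_0[OF e] char_1[OF e] by auto
    consider "s = 0" | "s = 1" | "0 < s" "s < 1" using st by fastforce
    then show "s = t"
    proof cases
      case 1
      then show ?thesis using st ne mid[of t] by (cases "t = 0"; cases "t = 1") auto
    next
      case 2
      then show ?thesis using st ne mid[of t] by (cases "t = 0"; cases "t = 1") auto
    next
      case 3
      then show ?thesis using st mid[of s] char_inj[OF e e, of s t] by (cases "t = 0"; cases "t = 1") auto
    qed
  qed
  then have "embedding_map (top_of_set {0..1}) X (char ?e)"
    using char_continuous[OF e] Hausdorff_X
    by (intro continuous_imp_embedding_map) (auto simp: compact_space_subtopology)
  from embedding_map_imp_homeomorphic_space[OF this]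
  have "top_of_set {0..1::real} homeomorphic_space subtopology X (char ?e ` {0..1})" by simp
  then show False
    using homeomorphic_space_trans circ closed_edge_eq[OF e] unit_interval_not_circle by metis
qed

text \<open>The characteristic map of an edge may run against the direction of the cycle. The change of
  parameter \<open>orient i\<close> is an involution, so it serves in both directions.\<close>

definition orient :: "nat \<Rightarrow> real \<Rightarrow> real" where
  "orient i u = (if char (es ! i) 0 = vs ! i \<and> char (es ! i) 1 = vs ! (Suc i mod L) then u else 1 - u)"

lemma orient_range: "u \<in> {0..1} \<Longrightarrow> orient i u \<in> {0..1}"
  and orient_orient: "orient i (orient i u) = u"
  by (auto simp: orient_def)

lemma orient_continuous: "continuous_on S (orient i)"
proof (cases "char (es ! i) 0 = vs ! i \<and> char (es ! i) 1 = vs ! (Suc i mod L)")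
  case True then show ?thesis by (simp add: orient_def[abs_def])
next
  case False
  have "continuous_on S (\<lambda>u::real. 1 - u)" by (intro continuous_intros)
  moreover have "orient i = (\<lambda>u. 1 - u)" using False by (auto simp: orient_def)
  ultimately show ?thesis by simp
qed

definition leg :: "nat \<Rightarrow> real \<Rightarrow> 'a" where
  "leg i u = char (es ! i) (orient i u)"

lemma leg_0: "i < L \<Longrightarrow> leg i 0 = vs ! i" and leg_1: "i < L \<Longrightarrow> leg i 1 = vs ! (Suc i mod L)"
  using es_ends[of i] by (auto simp: leg_def orient_def doubleton_eq_iff)

lemma leg_continuous: assumes "i < L" shows "continuous_map (top_of_set {0..1}) X (leg i)"
proof -
  have "continuous_map (top_of_set {0..1}) (top_of_set {0..1}) (orient i)"
    using orient_continuous orient_range by (auto simp: continuous_map_in_subtopology)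
  from continuous_map_compose[OF this char_continuous[OF es_edge[OF assms]]]
  show ?thesis by (simp add: o_def leg_def[abs_def])
qed

lemma leg_in_closed_edge: "i < L \<Longrightarrow> u \<in> {0..1} \<Longrightarrow> leg i u \<in> closed_edge G (es ! i)"
  using orient_range[of u i] by (simp add: leg_def closed_edge_eq es_edge)

lemma leg_corners: assumes "i < L" "u \<in> {0..1}" shows "corners (leg i u) \<subseteq> set vs"
proof -
  have "corners (leg i u) \<subseteq> {vs ! i, vs ! (Suc i mod L)}"
    using corners_char_subset[OF es_edge[OF assms(1)] orient_range[OF assms(2), of i]] es_ends[OF assms(1)]
    by (simp add: leg_def)
  also have "\<dots> \<subseteq> set vs" using assms(1) L_pos by auto
  finally show ?thesis .
qed

text \<open>The parametrisation of the cycle by the line, with period one. The \<open>L\<close> edges of the cycle take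
  equal times.\<close>

definition loop :: "real \<Rightarrow> 'a" where
  "loop t = leg (nat (\<lfloor>real L * t\<rfloor> mod int L)) (frac (real L * t))"

text \<open>The map to the circle that collapses the complement of the first open edge of the cycle to a
  point.\<close>

definition collapse :: "'a \<Rightarrow> complex" where
  "collapse = edgewise (\<lambda>_. 1) (\<lambda>e u. if e = es ! 0 then cis (2 * pi * orient 0 u) else 1)"

text \<open>The angle of \<open>collapse\<close> along \<open>loop\<close>: in each period it grows from one integer to the next on the
  first edge, and is constant on the others.\<close>

definition lift :: "real \<Rightarrow> real" where
  "lift t = of_int (\<lfloor>real L * t\<rfloor> div int L) + (if \<lfloor>real L * t\<rfloor> mod int L = 0 then frac (real L * t) else 1)"

lemma index_less: "nat (k mod int L) < L"
  using L_pos by (simp add: nat_less_iff)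

lemma mod_nonneg: "0 \<le> k mod int L"
  using pos_mod_sign[of "int L" k] L_pos by linarith

lemma frac_unit: "frac (x::real) \<in> {0..1}"
  by (simp add: frac_ge_0 less_imp_le[OF frac_lt_1])

lemma loop_continuous: "continuous_map euclideanreal X loop"
proof -
  have "continuous_map euclideanreal X (\<lambda>t. (\<lambda>k. leg (nat (k mod int L))) \<lfloor>t\<rfloor> (frac t))"
  proof (rule continuous_map_piecewise_unit)
    fix k :: int
    show "continuous_map (top_of_set {0..1}) X (leg (nat (k mod int L)))" by (rule leg_continuous[OF index_less])
    have "Suc (nat (k mod int L)) mod L = nat ((k + 1) mod int L)"
    proof -
      have "int (Suc (nat (k mod int L)) mod L) = (k mod L + 1) mod L"
        using L_pos by (simp add: zmod_int add.commute)
      also have "\<dots> = (k + 1) mod L" by (simp add: mod_add_left_eq)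
      finally show ?thesis by linarith
    qed
    then show "leg (nat (k mod int L)) 1 = leg (nat ((k + 1) mod int L)) 0"
      by (simp add: leg_1[OF index_less] leg_0[OF index_less])
  qed
  moreover have "continuous_map euclideanreal euclideanreal (\<lambda>t. real L * t)" by (auto intro!: continuous_intros)
  ultimately show ?thesis
    using continuous_map_compose[of euclideanreal euclideanreal "\<lambda>t. real L * t" X] by (simp add: o_def loop_def[abs_def])
qed

lemma lift_continuous: "continuous_on UNIV lift"
proof -
  have "continuous_map euclideanreal euclideanreal
    (\<lambda>t. (\<lambda>k u. of_int (k div int L) + (if k mod int L = 0 then u else 1)) \<lfloor>t\<rfloor> (frac t))"
  proof (rule continuous_map_piecewise_unit)
    fix k :: int
    show "continuous_map (top_of_set {0..1}) euclideanreal (\<lambda>u. of_int (k div int L) + (if k mod int L = 0 then u else 1))"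
      by (cases "k mod L = 0") (auto intro!: continuous_intros)
    have dm: "(k + 1) div L = (if k mod int L = int L - 1 then k div L + 1 else k div L) \<and>
        (k + 1) mod L = (if k mod int L = int L - 1 then 0 else k mod L + 1)"
    proof -
      have b: "0 \<le> k mod L" "k mod L < L" using L_pos by auto
      have k: "k = L * (k div int L) + k mod L" by simp
      show ?thesis
      proof (cases "k mod L = int L - 1")
        case True
        have "k + 1 = L * (k div L + 1)" using k True by (simp add: algebra_simps)
        then show ?thesis using True L_pos by simp
      next
        case False
        then have "k mod L + 1 < L" using b by simp
        moreover have "k + 1 = L * (k div int L) + (k mod L + 1)" using k by simp
        ultimately show ?thesis using False b
          by (metis add.commute div_mult_self4 div_pos_pos_trivial mod_mult_self2 mod_pos_pos_trivial add_nonneg_nonneg zero_le_one add_0 int_div_pos_eq int_mod_pos_eq)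
      qed
    qed
    show "of_int (k div int L) + (if k mod int L = 0 then 1 else 1) =
        real_of_int ((k + 1) div int L) + (if (k + 1) mod L = 0 then 0 else 1)"
      using dm mod_nonneg[of k] by (auto split: if_splits)
  qed
  moreover have "continuous_map euclideanreal euclideanreal (\<lambda>t. real L * t)" by (auto intro!: continuous_intros)
  ultimately have "continuous_map euclideanreal euclideanreal lift"
    using continuous_map_compose[of euclideanreal euclideanreal "\<lambda>t. real L * t" euclideanreal]
    by (simp add: o_def lift_def[abs_def])
  then show ?thesis by simp
qed

lemma scaled_floor: "\<lfloor>real L * (t + 1)\<rfloor> = \<lfloor>real L * t\<rfloor> + int L" "frac (real L * (t + 1)) = frac (real L * t)"
proof -
  have e: "real L * (t + 1) = real L * t + of_int (int L)" by (simp add: algebra_simps)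
  show "\<lfloor>real L * (t + 1)\<rfloor> = \<lfloor>real L * t\<rfloor> + int L" unfolding e by (rule floor_add_int[symmetric])
  then show "frac (real L * (t + 1)) = frac (real L * t)" unfolding frac_def e by simp
qed

lemma loop_periodic: "loop (t + 1) = loop t"
  unfolding loop_def scaled_floor by simp

lemma lift_period: "lift (t + 1) = lift t + 1"
  unfolding lift_def scaled_floor using L_pos by simp

lemma loop_corners: "corners (loop t) \<subseteq> set vs"
  unfolding loop_def by (intro leg_corners index_less frac_unit)

lemma loop_closed_edges: "loop t \<in> (\<Union>e\<in>set es. closed_edge G e)"
  unfolding loop_def using leg_in_closed_edge[OF index_less frac_unit] index_less length_es by (metis UN_I nth_mem)

lemma collapse_char:
  assumes "e \<in> edges G" "u \<in> {0..1}"
  shows "collapse (char e u) = (if e = es ! 0 then cis (2 * pi * orient 0 u) else 1)"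
  unfolding collapse_def by (subst edgewise_char_closed[OF assms]) (auto simp: orient_def)

lemma collapse_continuous: "continuous_map X euclidean collapse"
proof (rule continuous_map_on_edges)
  fix e assume e: "e \<in> edges G"
  have "continuous_on {0..1} (\<lambda>u. if e = es ! 0 then cis (2 * pi * orient 0 u) else 1)"
    by (cases "e = es ! 0") (auto intro!: continuous_intros orient_continuous)
  then have "continuous_map (top_of_set {0..1}) euclidean (\<lambda>u. if e = es ! 0 then cis (2 * pi * orient 0 u) else 1)"
    by (simp only: continuous_map_iff_continuous)
  then show "continuous_map (top_of_set {0..1}) euclidean (\<lambda>u. collapse (char e u))"
    by (rule continuous_map_eq) (use e in \<open>simp add: collapse_char\<close>)
qed auto

lemma norm_collapse: "x \<in> topspace X \<Longrightarrow> norm (collapse x) = 1"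
  by (erule point_cases) (auto simp: collapse_def edgewise_char)

lemma collapse_off_cycle:
  assumes "x \<in> topspace X" "corners x \<inter> set vs = {}" shows "collapse x = 1"
  using assms(1)
proof (cases rule: point_cases)
  case (2 e t)
  have "e \<noteq> es ! 0"
  proof
    assume "e = es ! 0"
    then have "corners x = {vs ! 0, vs ! (Suc 0 mod L)}" using 2 es_ends[of 0] L_pos by (simp add: corners_char)
    then show False using assms(2) L_pos by auto
  qed
  then show ?thesis using 2 by (simp add: collapse_def edgewise_char)
qed (simp add: collapse_def)

lemma collapse_loop: "collapse (loop t) = cis (2 * pi * lift t)"
proof -
  define i where "i = nat (\<lfloor>real L * t\<rfloor> mod int L)"
  have i: "i < L" unfolding i_def by (rule index_less)
  define u where "u = frac (real L * t)"
  have u: "u \<in> {0..1}" unfolding u_def by (rule frac_unit)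
  have c: "collapse (loop t) = (if es ! i = es ! 0 then cis (2 * pi * orient 0 (orient i u)) else 1)"
    unfolding loop_def leg_def i_def[symmetric] u_def[symmetric]
    using collapse_char[OF es_edge[OF i] orient_range[OF u]] .
  have i0: "i = 0 \<longleftrightarrow> \<lfloor>real L * t\<rfloor> mod int L = 0"
    using mod_nonneg[of "\<lfloor>real L * t\<rfloor>"] by (auto simp: i_def)
  show ?thesis
  proof (cases "i = 0")
    case True
    then have "collapse (loop t) = cis (2 * pi * u)" using c by (simp add: orient_orient)
    also have "\<dots> = cis (2 * pi * lift t)"
      using i0 True by (simp add: cis_eq_cis_2pi_iff lift_def u_def)
    finally show ?thesis .
  next
    case False
    then have "collapse (loop t) = cis (2 * pi * 0)" using c first_edge_once[of i] i by simp
    also have "\<dots> = cis (2 * pi * lift t)"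
      using i0 False by (subst cis_eq_cis_2pi_iff) (simp add: lift_def)
    finally show ?thesis .
  qed
qed

text \<open>In a homotopy through loops the two vertical sides of the square carry the same path, so the
  turning number of the loop is invariant. It is \<open>1\<close> for \<open>collapse \<circ> loop\<close> and \<open>0\<close> for a constant map.\<close>

lemma loop_not_nullhomotopic:
  "\<not> homotopic_with (\<lambda>g. g 0 = g 1) (top_of_set {0..1}) X loop (\<lambda>_. a)"
proof
  assume "homotopic_with (\<lambda>g. g 0 = g 1) (top_of_set {0..1}) X loop (\<lambda>_. a)"
  then obtain K where K: "continuous_map (prod_topology (top_of_set {0..1::real}) (top_of_set {0..1::real})) X K"
    "\<And>x. K (0, x) = loop x" "\<And>x. K (1, x) = a" "\<And>u. u \<in> {0..1} \<Longrightarrow> K (u, 0) = K (u, 1)"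
    unfolding homotopic_with_def by auto
  define H where "H = (\<lambda>u t. collapse (K (u, t)))"
  have KX: "K (u, t) \<in> topspace X" if "u \<in> {0..1}" "t \<in> {0..1}" for u t
    using continuous_map_image_subset_topspace[OF K(1)] that by auto
  have cont: "continuous_on ({0..1} \<times> {0..1}) (\<lambda>(u, t). H u t)"
    using continuous_map_compose[OF K(1) collapse_continuous] by (simp add: o_def H_def case_prod_unfold)
  have "turn (H 1) - turn (H 0) = turn (\<lambda>u. H u 1) - turn (\<lambda>u. H u 0)"
    by (rule turn_square[OF cont]) (simp add: H_def norm_collapse KX)
  moreover have "angle (\<lambda>u. H u 1) g \<longleftrightarrow> angle (\<lambda>u. H u 0) g" for g
    using K(4) by (simp add: angle_def H_def)
  then have "turn (\<lambda>u. H u 1) = turn (\<lambda>u. H u 0)" by (simp add: turn_def)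
  moreover have "turn (H 1) = 0"
    by (rule turn_const[of "collapse a"]) (use K(3) KX[of 1 0] in \<open>auto simp: H_def norm_collapse\<close>)
  moreover have "angle (H 0) lift"
    using K(2) continuous_on_subset[OF lift_continuous] by (simp add: angle_def H_def collapse_loop)
  then have "turn (H 0) = lift (0 + 1) - lift 0" by (simp add: turn_eq)
  ultimately show False unfolding lift_period by simp
qed

text \<open>An edge in the image of the loop is one of \<open>es\<close>, because different open edges are disjoint.\<close>

lemma length_cycle_ge:
  assumes "sufficiently_subdivided G n" shows "n + 1 \<le> L"
proof -
  have "pathin X loop" unfolding pathin_iff by (rule continuous_map_from_subtopology[OF loop_continuous])
  moreover have "loop 0 \<in> verts G"
    using leg_0[of 0] L_pos vs_verts by (auto simp: loop_def)
  moreover have "loop 1 = loop 0" using loop_periodic[of 0] by simp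
  ultimately have "n + 1 \<le> edge_count G loop"
    using assms loop_not_nullhomotopic unfolding sufficiently_subdivided_def by blast
  also have "edge_count G loop \<le> card (set es)"
    unfolding edge_count_def
  proof (intro card_mono subsetI)
    fix e assume "e \<in> {e \<in> edges G. closed_edge G e \<subseteq> loop ` {0..1}}"
    then have e: "e \<in> edges G" "closed_edge G e \<subseteq> loop ` {0..1}" by auto
    have "char e (1/2) \<in> closed_edge G e" using e by (simp add: closed_edge_eq)
    then obtain t where t: "char e (1/2) = loop t" using e(2) by blast
    obtain e' where e': "e' \<in> set es" "char e (1/2) \<in> closed_edge G e'"
      using loop_closed_edges[of t] unfolding t[symmetric] by (rule UN_E)
    have e'G: "e' \<in> edges G" using e' es_edges by blast
    then obtain s where s: "s \<in> {0..1}" "char e (1/2) = char e' s"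
      using e'(2) unfolding closed_edge_eq[OF e'G] by blast
    note e'G
    moreover from this have "s \<noteq> 0" "s \<noteq> 1"
      using s(2) char_0 char_1 char_notin_verts[OF e(1), of "1/2"] by auto
    ultimately have "e = e'" using char_inj[OF e(1), of e' "1/2" s] s by auto
    then show "e \<in> set es" using e' by simp
  qed simp
  also have "\<dots> \<le> L" using card_length[of es] length_es by simp
  finally show ?thesis .
qed

end

section \<open>Path connectedness of the configuration space\<close>

lemma rtranclp_leaves:
  assumes "R\<^sup>*\<^sup>* u v" "u \<in> S" "v \<notin> S" shows "\<exists>a\<in>S. \<exists>b. b \<notin> S \<and> R a b"
  using assms by (induction rule: converse_rtranclp_induct) auto

context graph_space begin

definition adjacent :: "'a \<Rightarrow> 'a \<Rightarrow> bool" where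
  "adjacent u v \<longleftrightarrow> (\<exists>e\<in>edges G. joins G e u v)"

lemma adjacent_sym: "adjacent u v \<Longrightarrow> adjacent v u"
  by (auto simp: adjacent_def joins_def insert_commute)

lemma adjacent_verts: "adjacent u v \<Longrightarrow> u \<in> verts G \<and> v \<in> verts G"
  using char_0 char_1 by (auto simp: adjacent_def joins_def doubleton_eq_iff)

text \<open>Otherwise the function that is \<open>1\<close> on the edges and vertices reachable from \<open>u\<close> and \<open>0\<close> on the
  others would be continuous with exactly two values on a connected space.\<close>

lemma adjacent_connected:
  assumes u: "u \<in> verts G" and v: "v \<in> verts G" shows "adjacent\<^sup>*\<^sup>* u v"
proof (rule ccontr)
  assume nv: "\<not> adjacent\<^sup>*\<^sup>* u v"
  define f where "f = edgewise (\<lambda>w. if adjacent\<^sup>*\<^sup>* u w then 1 else 0 :: real)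
    (\<lambda>e _. if adjacent\<^sup>*\<^sup>* u (char e 0) then 1 else 0)"
  have ends: "adjacent\<^sup>*\<^sup>* u (char e 0) \<longleftrightarrow> adjacent\<^sup>*\<^sup>* u (char e 1)" if "e \<in> edges G" for e
  proof -
    have "adjacent (char e 0) (char e 1)" using that by (auto simp: adjacent_def joins_def)
    then show ?thesis using adjacent_sym by (meson rtranclp.rtrancl_into_rtrancl)
  qed
  have f_char: "f (char e t) = (if adjacent\<^sup>*\<^sup>* u (char e 0) then 1 else 0)" if "e \<in> edges G" "t \<in> {0..1}" for e t
    unfolding f_def using ends[OF that(1)] by (subst edgewise_char_closed[OF that]) auto
  have "continuous_map X euclideanreal f"
  proof (rule continuous_map_on_edges)
    fix e assume e: "e \<in> edges G"
    have "continuous_map (top_of_set {0..1}) euclideanreal (\<lambda>t. if adjacent\<^sup>*\<^sup>* u (char e 0) then 1 else 0)"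
      by simp
    then show "continuous_map (top_of_set {0..1}) euclideanreal (\<lambda>t. f (char e t))"
      by (rule continuous_map_eq) (use e f_char in simp)
  qed auto
  then have "connectedin euclideanreal (f ` topspace X)"
    by (rule connectedin_continuous_map_image) (simp add: connectedin_topspace connected_X)
  then have "connected (f ` topspace X)" by simp
  moreover have "f u = 1" "f v = 0" using u v nv by (simp_all add: f_def)
  then have "0 \<in> f ` topspace X" "1 \<in> f ` topspace X"
    using u v verts_topspace by (metis imageI)+
  ultimately have "1/2 \<in> f ` topspace X"
    using connected_contains_Icc[of "f ` topspace X" 0 1] by auto
  then obtain x where x: "x \<in> topspace X" "f x = 1/2" by auto
  from x(1) show False
    by (cases rule: point_cases) (use x(2) f_char in \<open>auto simp: f_def split: if_splits\<close>)
qed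

lemma placements_confs: "f \<in> placements n (verts G) \<Longrightarrow> f \<in> confs n"
  unfolding placements_def confs_def using verts_topspace corners_vert
  by (auto simp: PiE_iff inj_on_def)

lemma path_component_of_discI:
  assumes "\<And>i. i < n \<Longrightarrow> continuous_map (top_of_set {0..1}) X (\<lambda>t. g t i)"
    and "\<And>t. t \<in> {0..1} \<Longrightarrow> g t \<in> extensional {..<n}"
    and "\<And>t i j. t \<in> {0..1} \<Longrightarrow> i < n \<Longrightarrow> j < n \<Longrightarrow> i \<noteq> j \<Longrightarrow> corners (g t i) \<inter> corners (g t j) = {}"
  shows "path_component_of (disc_conf n G) (g 0) (g (1::real))"
  unfolding path_component_of_def pathin_iff
  by (intro exI[of _ g] conjI continuous_map_disc_conf) (use assms in auto)

text \<open>While a token moves along an edge, its corners are the two ends of this edge, and no other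
  token sits there.\<close>

lemma path_component_pebble_move:
  assumes "pebble_move n (verts G) adjacent f g"
  shows "path_component_of (disc_conf n G) f g"
proof -
  obtain i w where f: "f \<in> placements n (verts G)" and i: "i < n" "w \<in> verts G" "adjacent (f i) w" "w \<notin> f ` {..<n}"
    and g: "g = f(i := w)"
    using assms unfolding pebble_move_def by blast
  obtain e where e: "e \<in> edges G" and ends: "{char e 0, char e 1} = {f i, w}"
    using i(3) by (auto simp: adjacent_def joins_def)
  obtain r where r: "continuous_map (top_of_set {0..1}) X r" "r 0 = f i" "r (1::real) = w"
    "\<And>t. t \<in> {0..1} \<Longrightarrow> corners (r t) \<subseteq> {f i, w}"
  proof (cases "char e 0 = f i \<and> char e 1 = w")
    case True
    then show thesis using that[of "char e"] char_continuous[OF e] corners_char_subset[OF e] by auto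
  next
    case False
    then have ends': "char e 0 = w" "char e 1 = f i" using ends by (auto simp: doubleton_eq_iff)
    have "continuous_map (top_of_set {0..1}) (top_of_set {0..1}) (\<lambda>t::real. 1 - t)"
      by (auto simp: continuous_map_in_subtopology intro!: continuous_intros)
    from continuous_map_compose[OF this char_continuous[OF e]]
    have "continuous_map (top_of_set {0..1}) X (\<lambda>t. char e (1 - t))" by (simp add: o_def)
    then show thesis using that[of "\<lambda>t. char e (1 - t)"] ends' corners_char_subset[OF e, of "1 - _"] by auto
  qed
  have fj: "f j \<in> verts G" if "j < n" for j using f that by (auto simp: placements_def)
  have other: "corners (f j) \<inter> {f i, w} = {}" if "j < n" "j \<noteq> i" for j
    using f i that fj[OF that(1)] by (auto simp: placements_def inj_on_def)
  have "path_component_of (disc_conf n G) (f(i := r 0)) (f(i := r 1))"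
  proof (rule path_component_of_discI)
    fix j assume "j < n"
    then show "continuous_map (top_of_set {0..1}) X (\<lambda>t. (f(i := r t)) j)"
      using r(1) fj verts_topspace by (cases "j = i") auto
  next
    fix t :: real and j k assume t: "t \<in> {0..1}" and jk: "j < n" "k < n" "j \<noteq> k"
    show "corners ((f(i := r t)) j) \<inter> corners ((f(i := r t)) k) = {}"
    proof (cases "j = i \<or> k = i")
      case True
      then show ?thesis using r(4)[OF t] other[of j] other[of k] jk by auto
    next
      case False
      then show ?thesis using placements_confs[OF f] jk by (simp add: confs_def)
    qed
  qed (use f i in \<open>auto simp: placements_def PiE_iff extensional_def\<close>)
  then show ?thesis by (simp add: r g)
qed

text \<open>Each token moves along its closed cell to the starting vertex of its edge. The corners of different
  tokens stay disjoint; in particular the final vertices are different.\<close>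

lemma path_component_placement:
  assumes x: "x \<in> confs n"
  obtains f where "f \<in> placements n (verts G)" "path_component_of (disc_conf n G) x f"
proof -
  have "\<exists>r. continuous_map (top_of_set {0..1}) X r \<and> r 0 = y \<and> r (1::real) \<in> verts G \<and>
      (\<forall>t\<in>{0..1}. corners (r t) \<subseteq> corners y)" if "y \<in> topspace X" for y
    using that
  proof (cases rule: point_cases)
    case 1 then show ?thesis using that by (intro exI[of _ "\<lambda>_. y"]) auto
  next
    case (2 e t)
    have "continuous_map (top_of_set {0..1}) (top_of_set {0..1}) (\<lambda>s. (1 - s) * t)"
      using 2 by (auto simp: continuous_map_in_subtopology mult_le_one intro!: continuous_intros)
    from continuous_map_compose[OF this char_continuous[OF 2(1)]]
    have "continuous_map (top_of_set {0..1}) X (\<lambda>s. char e ((1 - s) * t))" by (simp add: o_def)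
    moreover have "(1 - s) * t \<in> {0..1}" if "s \<in> {0..1}" for s
      using 2 that by (auto simp: mult_le_one)
    ultimately show ?thesis using 2 char_0 corners_char_subset[OF 2(1)]
      by (intro exI[of _ "\<lambda>s. char e ((1 - s) * t)"]) (auto simp: corners_char)
  qed
  then have "\<forall>i. \<exists>r. i < n \<longrightarrow> continuous_map (top_of_set {0..1}) X r \<and> r 0 = x i \<and> r (1::real) \<in> verts G \<and>
      (\<forall>t\<in>{0..1}. corners (r t) \<subseteq> corners (x i))"
    using confs_topspace[OF x] by meson
  then obtain r where r: "\<And>i. i < n \<Longrightarrow> continuous_map (top_of_set {0..1}) X (r i)"
    "\<And>i. i < n \<Longrightarrow> r i 0 = x i" "\<And>i. i < n \<Longrightarrow> r i (1::real) \<in> verts G"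
    "\<And>i t. i < n \<Longrightarrow> t \<in> {0..1} \<Longrightarrow> corners (r i t) \<subseteq> corners (x i)"
    by metis
  define g where "g = (\<lambda>t. \<lambda>i\<in>{..<n}. r i t)"
  have disj: "corners (g t i) \<inter> corners (g t j) = {}" if "t \<in> {0..1}" "i < n" "j < n" "i \<noteq> j" for t i j
  proof -
    have "corners (x i) \<inter> corners (x j) = {}" using x that by (simp add: confs_def)
    then show ?thesis using r(4)[OF that(2,1)] r(4)[OF that(3,1)] that by (auto simp: g_def)
  qed
  have "path_component_of (disc_conf n G) (g 0) (g 1)"
  proof (rule path_component_of_discI)
    show "continuous_map (top_of_set {0..1}) X (\<lambda>t. g t i)" if "i < n" for i
      using r(1) that by (simp add: g_def)
    show "g t \<in> extensional {..<n}" for t unfolding g_def by (rule restrict_extensional)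
  qed (rule disj)
  moreover have "g 0 = x"
  proof
    fix i show "g 0 i = x i"
      using x r(2) by (auto simp: g_def confs_def PiE_iff extensional_def)
  qed
  moreover have "g 1 \<in> placements n (verts G)"
  proof -
    have "g 1 i \<noteq> g 1 j" if "i < n" "j < n" "i \<noteq> j" for i j
      using disj[of 1, OF _ that] r(3)[OF that(1)] that by (auto simp: g_def)
    then have "inj_on (g 1) {..<n}" by (auto simp: inj_on_def)
    then show ?thesis using r(3) by (auto simp: placements_def g_def)
  qed
  ultimately show thesis using that by metis
qed

text \<open>A vertex off the cycle guarantees, by connectedness, an edge that leaves the cycle; its end serves as the
  exit for exchanging tokens.\<close>

theorem path_connected_disc_conf:
  assumes cycle: "is_cycle G (vs, es)" and other: "v' \<in> verts G" "v' \<notin> set vs"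
    and n: "2 \<le> n" and sub: "sufficiently_subdivided G n"
  shows "path_connected_space (disc_conf n G)"
proof -
  interpret graph_cycle G vs es by unfold_locales (rule cycle)
  have nL: "n < L" using length_cycle_ge[OF sub] by simp
  obtain w y where w: "w \<in> set vs" and y: "y \<notin> set vs" "adjacent w y"
  proof -
    have "vs ! 0 \<in> set vs" using L_pos by simp
    then have "adjacent\<^sup>*\<^sup>* (vs ! 0) v'" using adjacent_connected other vs_verts by blast
    then show thesis using rtranclp_leaves[of adjacent "vs ! 0" v' "set vs"] other \<open>vs ! 0 \<in> set vs\<close> that by blast
  qed
  obtain k where k: "k < L" "w = vs ! k" using w by (metis in_set_conv_nth)
  \<comment> \<open>the cycle, renumbered such that it starts at the vertex with the exit\<close>
  define z where "z = (\<lambda>i. vs ! ((k + i) mod L))"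
  have less: "i mod L < L" for i using L_pos by simp
  interpret pebble_cycle n "verts G" adjacent L z y
  proof
    show "n < L" "3 \<le> L" using nL n by auto
    show "adjacent u v" if "adjacent v u" for u v using that by (rule adjacent_sym)
    show "u \<in> verts G \<and> v \<in> verts G" if "adjacent u v" for u v using that by (rule adjacent_verts)
    show "inj_on z {..<L}"
    proof (rule inj_onI)
      fix i j assume ij: "i \<in> {..<L}" "j \<in> {..<L}" "z i = z j"
      then have eq: "(k + i) mod L = (k + j) mod L"
        using distinct_vs less unfolding z_def by (simp add: nth_eq_iff_index_eq)
      then show "i = j" using ij mod_shift_eq_iff[of k "k + i" "k + j" L] by simp
    qed
    show "adjacent (z i) (z (Suc i mod L))" if "i < L" for i
    proof -
      have "Suc ((k + i) mod L) mod L = (k + Suc i mod L) mod L"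
        by (simp add: mod_Suc_eq mod_add_right_eq)
      then show ?thesis
        using cycle_joins[OF less, of "k + i"] es_edge[OF less, of "k + i"] unfolding adjacent_def z_def by auto
    qed
    show "adjacent (z 0) y" using y k by (simp add: z_def)
    show "y \<notin> z ` {..<L}" using y less by (auto simp: z_def)
  qed
  have reach: "path_component_of (disc_conf n G) f g"
    if f: "f \<in> placements n (verts G)" and g: "g \<in> placements n (verts G)" for f g
  proof -
    have "reach f g" using placements_reachable[OF adjacent_connected f g] .
    then show ?thesis
    proof (induction rule: rtranclp_induct)
      case base
      then show ?case using placements_confs[OF f] by (simp add: path_component_of_refl topspace_disc_conf)
    next
      case (step b c)
      show ?case by (rule path_component_of_trans[OF step.IH path_component_pebble_move[OF step.hyps(2)]])
    qed
  qed
  show ?thesis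
    unfolding path_connected_space_iff_path_component
  proof (intro ballI)
    fix x y assume "x \<in> topspace (disc_conf n G)" "y \<in> topspace (disc_conf n G)"
    then have xy: "x \<in> confs n" "y \<in> confs n" by (simp_all add: topspace_disc_conf)
    obtain f where f: "f \<in> placements n (verts G)" "path_component_of (disc_conf n G) x f"
      using path_component_placement[OF xy(1)] .
    obtain g where g: "g \<in> placements n (verts G)" "path_component_of (disc_conf n G) y g"
      using path_component_placement[OF xy(2)] .
    show "path_component_of (disc_conf n G) x y"
      using path_component_of_trans[OF f(2) path_component_of_trans[OF reach[OF f(1) g(1)]]] g(2)
      by (simp add: path_component_of_sym)
  qed
qed

end

section \<open>The topological complexity\<close>

text \<open>The maximum in the definition of \<open>nu\<close> is attained, since the set of cycles is finite.\<close>

lemma disjoint_cycles_exist: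
  assumes G: "is_graph G" and n: "n \<le> nu G" "0 < n"
  obtains cy where "\<And>i. i < n \<Longrightarrow> is_cycle G (cy i)"
    "\<And>i j. i < n \<Longrightarrow> j < n \<Longrightarrow> i \<noteq> j \<Longrightarrow> set (fst (cy i)) \<inter> set (fst (cy j)) = {}"
proof -
  define good where "good = (\<lambda>C. (\<forall>c\<in>C. is_cycle G c) \<and> pairwise (\<lambda>c d. set (fst c) \<inter> set (fst d) = {}) C)"
  have fv: "finite (verts G)" "finite (edges G)" using G by (auto simp: is_graph_def)
  define All where "All = {vs. set vs \<subseteq> verts G \<and> length vs \<le> card (verts G)} \<times> {es. set es \<subseteq> edges G \<and> length es \<le> card (verts G)}"
  have finA: "finite All" unfolding All_def using fv by (intro finite_cartesian_product finite_lists_length_le)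
  have "c \<in> All" if "is_cycle G c" for c
  proof -
    obtain vs es where c: "c = (vs, es)" by force
    have "distinct vs" "set vs \<subseteq> verts G" "length es = length vs" "set es \<subseteq> edges G"
      using that by (auto simp: is_cycle_def c)
    moreover from this have "length vs \<le> card (verts G)"
      using card_mono[OF fv(1)] by (metis distinct_card)
    ultimately show ?thesis by (simp add: All_def c)
  qed
  then have sub: "C \<subseteq> All" if "good C" for C using that by (auto simp: good_def)
  have "{card C | C. good C} \<subseteq> {..card All}" using sub card_mono[OF finA] by auto
  then have fin: "finite {card C | C. good C}" by (rule finite_subset) simp
  have "good {}" by (simp add: good_def)
  then have ne: "{card C | C. good C} \<noteq> {}" by blast
  have "nu G = Max {card C | C. good C}" by (simp add: nu_def good_def)
  then have "nu G \<in> {card C | C. good C}" using Max_in[OF fin ne] by simp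
  then obtain C where C: "good C" "nu G = card C" by auto
  obtain T where T: "T \<subseteq> C" "card T = n" "finite T" using obtain_subset_with_card_n n C by metis
  obtain cy where cy: "bij_betw cy {0..<n} T" using ex_bij_betw_nat_finite[OF T(3)] T(2) by blast
  show thesis
  proof
    show "is_cycle G (cy i)" if "i < n" for i
    proof -
      have "cy i \<in> C" using that T(1) bij_betwE[OF cy] by auto
      then show ?thesis using C(1) by (simp add: good_def)
    qed
    show "set (fst (cy i)) \<inter> set (fst (cy j)) = {}" if "i < n" "j < n" "i \<noteq> j" for i j
    proof -
      have "cy i \<in> C" "cy j \<in> C" using that T(1) bij_betwE[OF cy] by auto
      moreover have "cy i \<noteq> cy j" using that inj_onD[OF bij_betw_imp_inj_on[OF cy], of i j] by auto
      ultimately show ?thesis using C(1) by (simp add: good_def pairwise_def)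
    qed
  qed
qed

text \<open>On the first torus token \<open>i\<close> runs around cycle \<open>i\<close>, on the second one around cycle \<open>\<sigma> i\<close>, where \<open>\<sigma>\<close> is a
  permutation without fixed points; this is where two tokens are needed. Composing the \<open>i\<close>-th
  coordinate with the collapse of cycle \<open>i\<close> thus detects the \<open>i\<close>-th circle of the first torus and is
  constant on the second, while composing it with the collapse of cycle \<open>\<sigma> i\<close> does the opposite.\<close>

theorem (in graph_space) TC_disc_conf_ge:
  assumes cy: "\<And>i. i < n \<Longrightarrow> is_cycle G (cy i)"
    and disj: "\<And>i j. i < n \<Longrightarrow> j < n \<Longrightarrow> i \<noteq> j \<Longrightarrow> set (fst (cy i)) \<inter> set (fst (cy j)) = {}"
    and n: "2 \<le> n"
  shows "enat (2 * n + 1) \<le> TC (disc_conf n G)"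
proof -
  let ?D = "disc_conf n G"
  have gc: "graph_cycle G (fst (cy i)) (snd (cy i))" if "i < n" for i
    using cy[OF that] by unfold_locales simp
  define c where "c = (\<lambda>i. graph_cycle.loop G (fst (cy i)) (snd (cy i)))"
  define q where "q = (\<lambda>i. graph_cycle.collapse G (fst (cy i)) (snd (cy i)))"
  define h where "h = (\<lambda>i. graph_cycle.lift (fst (cy i)))"
  have c: "continuous_map euclideanreal X (c i)" "\<And>t. c i (t + 1) = c i t" "\<And>t. corners (c i t) \<subseteq> set (fst (cy i))"
    and q: "continuous_map X euclidean (q i)" "\<And>x. x \<in> topspace X \<Longrightarrow> norm (q i x) = 1"
      "\<And>x. x \<in> topspace X \<Longrightarrow> corners x \<inter> set (fst (cy i)) = {} \<Longrightarrow> q i x = 1"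
    and h: "continuous_on UNIV (h i)" "\<And>t. h i (t + 1) = h i t + 1" "\<And>t. q i (c i t) = cis (2 * pi * h i t)"
    if "i < n" for i
  proof -
    interpret graph_cycle G "fst (cy i)" "snd (cy i)" by (rule gc[OF that])
    show "continuous_map euclideanreal X (c i)" unfolding c_def by (rule loop_continuous)
    show "c i (t + 1) = c i t" for t unfolding c_def by (rule loop_periodic)
    show "corners (c i t) \<subseteq> set (fst (cy i))" for t unfolding c_def by (rule loop_corners)
    show "continuous_map X euclidean (q i)" unfolding q_def by (rule collapse_continuous)
    show "x \<in> topspace X \<Longrightarrow> norm (q i x) = 1" for x unfolding q_def by (rule norm_collapse)
    show "x \<in> topspace X \<Longrightarrow> corners x \<inter> set (fst (cy i)) = {} \<Longrightarrow> q i x = 1" for x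
      unfolding q_def by (rule collapse_off_cycle)
    show "continuous_on UNIV (h i)" unfolding h_def by (rule lift_continuous)
    show "h i (t + 1) = h i t + 1" for t unfolding h_def by (rule lift_period)
    show "q i (c i t) = cis (2 * pi * h i t)" for t unfolding c_def q_def h_def by (rule collapse_loop)
  qed
  have cX: "c i t \<in> topspace X" if "i < n" for i t
    using continuous_map_image_subset_topspace[OF c(1)[OF that]] by auto
  have c_int: "c i s = c i t" if i: "i < n" and st: "s - t \<in> \<int>" for i s t
  proof -
    have nat: "c i (t + real k) = c i t" for t k
    proof (induction k)
      case (Suc k)
      have "c i (t + real (Suc k)) = c i ((t + real k) + 1)" by (simp add: add.assoc add.commute[of 1])
      then show ?case using c(2)[OF i] Suc by simp
    qed simp
    obtain k where k: "s - t = of_int k" using st by (auto elim: Ints_cases)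
    show ?thesis
    proof (cases "k \<ge> 0")
      case True
      then have "s = t + real (nat k)" using k by simp
      then show ?thesis using nat by simp
    next
      case False
      then have "t = s + real (nat (- k))" using k by simp
      then show ?thesis using nat[of s "nat (- k)"] by simp
    qed
  qed
  have c_off: "q i (c j t) = 1" if "i < n" "j < n" "i \<noteq> j" for i j t
    using q(3)[OF that(1) cX[OF that(2)]] c(3)[OF that(2)] disj[OF that] by blast
  define \<sigma> where "\<sigma> = (\<lambda>i. Suc i mod n)"
  have \<sigma>: "\<sigma> i < n" "\<sigma> i \<noteq> i" if "i < n" for i
    using that n by (auto simp: \<sigma>_def mod_if)
  have \<sigma>_inj: "\<sigma> i \<noteq> \<sigma> j" if "i < n" "j < n" "i \<noteq> j" for i j
    using that n by (auto simp: \<sigma>_def mod_if)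
  define \<gamma> where "\<gamma> = (\<lambda>x::nat \<Rightarrow> real. (\<lambda>i\<in>{..<n}. c i (x i), \<lambda>i\<in>{..<n}. c (\<sigma> i) (x (n + i))))"
  have coord: "continuous_map euclidean euclideanreal (\<lambda>x::nat \<Rightarrow> real. x i)" for i
    by simp
  have torus: "continuous_map euclidean ?D (\<lambda>x::nat \<Rightarrow> real. \<lambda>i\<in>{..<n}. c (\<rho> i) (x (\<kappa> i)))"
    if \<rho>: "\<And>i. i < n \<Longrightarrow> \<rho> i < n" "\<And>i j. i < n \<Longrightarrow> j < n \<Longrightarrow> i \<noteq> j \<Longrightarrow> \<rho> i \<noteq> \<rho> j" for \<rho> \<kappa>
  proof (rule continuous_map_disc_conf)
    fix i assume i: "i < n"
    from continuous_map_compose[OF coord c(1)[OF \<rho>(1)[OF i]]]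
    show "continuous_map euclidean X (\<lambda>x::nat \<Rightarrow> real. (\<lambda>i\<in>{..<n}. c (\<rho> i) (x (\<kappa> i))) i)"
      using i by (simp add: o_def)
  next
    fix x :: "nat \<Rightarrow> real" and i j assume ij: "i < n" "j < n" "i \<noteq> j"
    show "corners ((\<lambda>i\<in>{..<n}. c (\<rho> i) (x (\<kappa> i))) i) \<inter> corners ((\<lambda>i\<in>{..<n}. c (\<rho> i) (x (\<kappa> i))) j) = {}"
      using c(3)[OF \<rho>(1)[OF ij(1)], of "x (\<kappa> i)"] c(3)[OF \<rho>(1)[OF ij(2)], of "x (\<kappa> j)"]
        disj[OF \<rho>(1)[OF ij(1)] \<rho>(1)[OF ij(2)] \<rho>(2)[OF ij]] ij
      by simp blast
  qed auto
  have \<gamma>: "continuous_map euclidean (prod_topology ?D ?D) \<gamma>"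
    unfolding \<gamma>_def using \<sigma> \<sigma>_inj by (intro continuous_map_pairedI torus) auto
  have per: "\<gamma> x = \<gamma> y" if "\<And>j. j < 2 * n \<Longrightarrow> x j - y j \<in> \<int>" for x y
    unfolding \<gamma>_def using that \<sigma> by (auto intro!: restrict_ext c_int)
  \<comment> \<open>The complex conjugate makes the difference of the angles at the two ends grow, and not
    decrease, also for the second torus.\<close>
  define f where "f = (\<lambda>j x. if j < n then q j (x j) else cnj (q (\<sigma> (j - n)) (x (j - n))))"
  define a where "a = (\<lambda>j t. if j < n then h j t else 0)"
  define b where "b = (\<lambda>j t. if j < n then 0 else - h (\<sigma> (j - n)) t)"
  have jn: "j - n < n" if "j < 2 * n" "\<not> j < n" for j using that by simp
  have "2 * n < k"
    if U: "\<forall>i<k. openin (prod_topology ?D ?D) (U i) \<and> has_section_on ?D (U i)" "(\<Union>i<k. U i) = topspace (prod_topology ?D ?D)"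
    for k U
  proof (rule number_of_sections_gt[where m = "2 * n" and f = f and a = a and b = b, OF \<gamma> per])
    fix j assume j: "j < 2 * n"
    show "continuous_map ?D euclidean (f j)"
    proof (cases "j < n")
      case True
      from continuous_map_compose[OF continuous_map_disc_conf_coord[OF True] q(1)[OF True]]
      show ?thesis using True by (simp add: f_def o_def)
    next
      case False
      have "continuous_map euclidean euclidean cnj" by (simp add: continuous_on_cnj)
      from continuous_map_compose[OF continuous_map_compose[OF continuous_map_disc_conf_coord[OF jn[OF j False]] q(1)[OF \<sigma>(1)[OF jn[OF j False]]]] this]
      show ?thesis using False by (simp add: f_def o_def)
    qed
    show "norm (f j x) = 1" if "x \<in> topspace ?D" for x
      using that confs_topspace[of x n j] confs_topspace[of x n "j - n"] q(2) \<sigma>(1) jn[OF j]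
      by (simp add: f_def topspace_disc_conf)
    show "continuous_on UNIV (a j)" "continuous_on UNIV (b j)"
      using h(1) \<sigma>(1) jn[OF j] by (cases "j < n"; auto simp: a_def b_def intro!: continuous_intros)+
    show "f j (fst (\<gamma> x)) = cis (2 * pi * a j (x j))" for x
      using h(3)[of j] c_off[of "\<sigma> (j - n)" "j - n"] \<sigma>[of "j - n"] jn[OF j] by (simp add: f_def \<gamma>_def a_def)
    show "f j (snd (\<gamma> x)) = cis (2 * pi * b j (x j))" for x
      using h(3)[of "\<sigma> (j - n)"] c_off[of j "\<sigma> j"] \<sigma>[of "j - n"] \<sigma>[of j] jn[OF j]
      by (auto simp: f_def \<gamma>_def b_def cis_cnj)
    show "a j (t + 1) - b j (t + 1) = a j t - b j t + 1" for t
      using h(2) \<sigma>(1)[of "j - n"] jn[OF j] by (simp add: a_def b_def)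
  next
    show "openin (prod_topology ?D ?D) (U i)" "has_section_on ?D (U i)" if "i < k" for i
      using U(1) that by blast+
    show "topspace (prod_topology ?D ?D) \<subseteq> (\<Union>i<k. U i)" unfolding U(2) ..
  qed
  then show ?thesis
    unfolding TC_def by (intro Inf_greatest) (auto simp: Suc_le_eq)
qed

theorem theorem2p2:
  fixes G :: "('a, 'e) graph" and n :: nat
  assumes "is_graph G"
    and "nu G \<ge> 2"
    and "2 \<le> n" and "n \<le> nu G"
    and "sufficiently_subdivided G n"
  shows "TC (disc_conf n G) = enat (2 * n + 1)"
proof -
  interpret graph_space G by unfold_locales (rule assms(1))
  obtain cy where cy: "\<And>i. i < n \<Longrightarrow> is_cycle G (cy i)"
    "\<And>i j. i < n \<Longrightarrow> j < n \<Longrightarrow> i \<noteq> j \<Longrightarrow> set (fst (cy i)) \<inter> set (fst (cy j)) = {}"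
    by (rule disjoint_cycles_exist[OF assms(1,4)]) (use assms(3) in auto)
  have 01: "0 < n" "1 < n" using assms(3) by auto
  interpret c1: graph_cycle G "fst (cy 1)" "snd (cy 1)" using cy(1)[OF 01(2)] by unfold_locales simp
  have v: "fst (cy 1) ! 0 \<in> set (fst (cy 1))" using c1.L_pos by simp
  have "path_connected_space (disc_conf n G)"
  proof (rule path_connected_disc_conf)
    show "is_cycle G (fst (cy 0), snd (cy 0))" using cy(1)[OF 01(1)] by simp
    show "fst (cy 1) ! 0 \<in> verts G" using v c1.vs_verts by blast
    show "fst (cy 1) ! 0 \<notin> set (fst (cy 0))" using v cy(2)[OF 01] by auto
  qed (use assms in auto)
  then show ?thesis
    using TC_disc_conf_le TC_disc_conf_ge[OF cy assms(3)] by (intro antisym)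
qed

end
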